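(* Let $(M,\eta,g)$ be a pseudo-Riemannian contact manifold, let $(\pi,\xi)$ be the Jacobi structure associated with the contact form $\eta$, let $\mathcal{D}$ be the contravariant Levi-Civita derivative associated with $(\pi,\xi,g)$ and let $\nabla$ be the Levi-Civita connection of $g$. Then $$\sharp_\eta(\mathcal{D}_\alpha\beta)=\nabla_{\sharp_\eta(\alpha)}\sharp_\eta(\beta)\qquad\text{for all }\alpha,\beta\in\Omega^1(M).$$
   Context: A contact form on a manifold $M$ of dimension $2n+1$ ($n\ge1$) is a $1$-form $\eta$ with $\eta\wedge(d\eta)^n$ a volume form. Then $\flat_\eta:TM\to T^*M$, $\flat_\eta(X)=-i_Xd\eta+\eta(X)\eta$, is an isomorphism with inverse $\sharp_\eta$. The associated Jacobi structure is $\pi(\alpha,\beta)=d\eta(\sharp_\eta(\alpha),\sharp_\eta(\beta))$, $\xi=\sharp_\eta(\eta)$ (Reeb field: $i_\xi d\eta=0$, $\eta(\xi)=1$). A pseudo-Riemannian almost contact structure is $(\Phi,\xi,\eta,g)$ with $\Phi$ a $(1,1)$-tensor field, $\xi$ a vector field, $\eta$ a $1$-form, $g$ a pseudo-Riemannian metric, such that $\Phi^2=-\mathrm{Id}_{TM}+\eta\otimes\xi$, $\eta(\xi)=1$ and $g(\Phi(X),\Phi(Y))=g(X,Y)-\eta(X)\eta(Y)$. For a contact form $\eta$ with Reeb field $\xi$, $(M,\eta,g)$ is a pseudo-Riemannian contact manifold if there is an endomorphism field $\Phi$ of $TM$ such that $(\Phi,\xi,\eta,g)$ is a pseudo-Riemannian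 almost contact structure and $g(X,\Phi(Y))=d\eta(X,Y)$. Define $\sharp_\pi:T^*M\to TM$ by $\beta(\sharp_\pi(\alpha))=\pi(\alpha,\beta)$; $[\alpha,\beta]_\pi=\mathcal{L}_{\sharp_\pi(\alpha)}\beta-\mathcal{L}_{\sharp_\pi(\beta)}\alpha-d(\pi(\alpha,\beta))$; $\sharp_{\pi,\xi}(\alpha)=\sharp_\pi(\alpha)+\alpha(\xi)\xi$; and, for $\lambda\in\Omega^1(M)$, $$[\alpha,\beta]_{\pi,\xi}^{\lambda}=[\alpha,\beta]_\pi+\alpha(\xi)(\mathcal{L}_\xi\beta-\beta)-\beta(\xi)(\mathcal{L}_\xi\alpha-\alpha)-\pi(\alpha,\beta)\lambda .$$ Let $\flat_g(X)(Y)=g(X,Y)$, $\sharp_g=\flat_g^{-1}$, $g^*(\alpha,\beta)=g(\sharp_g(\alpha),\sharp_g(\beta))$, and let $J:TM\to TM$ be defined by $g(J\sharp_g(\alpha),\sharp_g(\beta))=\pi(\alpha,\beta)$. Put $\lambda=g(\xi,\xi)\flat_g(\xi)-\flat_g(J\xi)$ and $[\cdot,\cdot]_{\pi,\xi}^{g}:=[\cdot,\cdot]_{\pi,\xi}^{\lambda}$ for this $\lambda$. The contravariant Levi-Civita derivative of $(\pi,\xi,g)$ is the unique contravariant derivative $\mathcal{D}:\Omega^1(M)\times\Omega^1(M)\to\Omega^1(M)$ ($\mathbb{R}$-bilinear, $\mathcal{D}_{\varphi\alpha}\beta=\varphi\mathcal{D}_\alpha\beta$, $\mathcal{D}_\alpha(\varphi\beta)=\varphi\mathcal{D}_\alpha\beta+\sharp_{\pi,\xi}(\alpha)(\varphi)\beta$)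 satisfying $\mathcal{D}_\alpha\beta-\mathcal{D}_\beta\alpha=[\alpha,\beta]_{\pi,\xi}^{g}$ and $\sharp_{\pi,\xi}(\alpha)\cdot g^*(\beta,\gamma)=g^*(\mathcal{D}_\alpha\beta,\gamma)+g^*(\beta,\mathcal{D}_\alpha\gamma)$. *)

theory Defs
  imports "HOL-Analysis.Analysis"
begin

section \<open>Smooth functions and smooth manifolds\<close>

text \<open>The predicates \<open>Ck_on\<close> and \<open>smooth_on\<close> are meant for open \<open>S\<close>.\<close>

fun Ck_on :: "nat \<Rightarrow> 'e::euclidean_space set \<Rightarrow> ('e \<Rightarrow> 'b::real_normed_vector) \<Rightarrow> bool" where
  "Ck_on 0 S f \<longleftrightarrow> continuous_on S f"
| "Ck_on (Suc k) S f \<longleftrightarrow>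
     (\<forall>x\<in>S. f differentiable (at x)) \<and>
     (\<forall>v. Ck_on k S (\<lambda>x. frechet_derivative f (at x) v))"

definition smooth_on :: "'e::euclidean_space set \<Rightarrow> ('e \<Rightarrow> 'b::real_normed_vector) \<Rightarrow> bool" where
  "smooth_on S f \<longleftrightarrow> (\<forall>k. Ck_on k S f)"

text \<open>The points of the manifold are the elements of the type \<open>'a\<close>; the topology of the
  manifold is that of the type. A chart is a domain together with a coordinate map, whose values
  outside the domain are irrelevant. The atlas need not be maximal.\<close>

type_synonym ('a, 'e) chart = "'a set \<times> ('a \<Rightarrow> 'e)"

definition smooth_manifold ::
  "('a::{t2_space,second_countable_topology}, 'e::euclidean_space) chart set \<Rightarrow> bool" where
  "smooth_manifold A \<longleftrightarrow>
     (\<Union>(U, \<phi>)\<in>A. U) = UNIV \<and>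
     (\<forall>(U, \<phi>)\<in>A. open U \<and> open (\<phi> ` U) \<and> homeomorphism U (\<phi> ` U) \<phi> (inv_into U \<phi>)) \<and>
     (\<forall>(U, \<phi>)\<in>A. \<forall>(V, \<psi>)\<in>A. smooth_on (\<phi> ` (U \<inter> V)) (\<psi> \<circ> inv_into U \<phi>))"

definition smooth_functions ::
  "('a::{t2_space,second_countable_topology}, 'e::euclidean_space) chart set \<Rightarrow> ('a \<Rightarrow> real) set" where
  "smooth_functions A = {f. \<forall>(U, \<phi>)\<in>A. smooth_on (\<phi> ` U) (f \<circ> inv_into U \<phi>)}"


section \<open>Vector fields and tensor fields\<close>

text \<open>A tangent vector at \<open>p\<close> is a derivation at \<open>p\<close> of the algebra of smooth functions. As HOL
  functions are total, it is extended by \<open>0\<close> to functions that are not smooth, so that equality of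
  tangent vectors is equality of HOL functions. A vector field is a section of the tangent bundle
  that maps smooth functions to smooth functions.\<close>

type_synonym 'a tangent_vector = "('a \<Rightarrow> real) \<Rightarrow> real"
type_synonym 'a vector_field = "'a \<Rightarrow> 'a tangent_vector"

definition tangent_space ::
  "('a::{t2_space,second_countable_topology}, 'e::euclidean_space) chart set \<Rightarrow> 'a
     \<Rightarrow> 'a tangent_vector set" where
  "tangent_space A p = {v.
     (\<forall>f\<in>smooth_functions A. \<forall>h\<in>smooth_functions A. v (\<lambda>q. f q + h q) = v f + v h) \<and>
     (\<forall>c. \<forall>f\<in>smooth_functions A. v (\<lambda>q. c * f q) = c * v f) \<and>
     (\<forall>f\<in>smooth_functions A. \<forall>h\<in>smooth_functions A.
        v (\<lambda>q. f q * h q) = f p * v h + h p * v f) \<and>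
     (\<forall>f. f \<notin> smooth_functions A \<longrightarrow> v f = 0)}"

definition vector_fields ::
  "('a::{t2_space,second_countable_topology}, 'e::euclidean_space) chart set
     \<Rightarrow> 'a vector_field set" where
  "vector_fields A = {X.
     (\<forall>p. X p \<in> tangent_space A p) \<and>
     (\<forall>f\<in>smooth_functions A. (\<lambda>p. X p f) \<in> smooth_functions A)}"

definition vf_apply :: "'a vector_field \<Rightarrow> ('a \<Rightarrow> real) \<Rightarrow> 'a \<Rightarrow> real" where
  "vf_apply X f = (\<lambda>p. X p f)"

definition vf_add :: "'a vector_field \<Rightarrow> 'a vector_field \<Rightarrow> 'a vector_field" where
  "vf_add X Y = (\<lambda>p f. X p f + Y p f)"

definition vf_scale :: "('a \<Rightarrow> real) \<Rightarrow> 'a vector_field \<Rightarrow> 'a vector_field" where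
  "vf_scale \<phi> X = (\<lambda>p f. \<phi> p * X p f)"

definition vf_diff :: "'a vector_field \<Rightarrow> 'a vector_field \<Rightarrow> 'a vector_field" where
  "vf_diff X Y = (\<lambda>p f. X p f - Y p f)"

definition lie_bracket :: "'a vector_field \<Rightarrow> 'a vector_field \<Rightarrow> 'a vector_field" where
  "lie_bracket X Y = (\<lambda>p f. X p (vf_apply Y f) - Y p (vf_apply X f))"

text \<open>Covariant tensor fields are multilinear maps over the ring of smooth functions, from vector
  fields to smooth functions. One-forms are extended by \<open>0\<close> to arguments that are not vector
  fields, again to make equality of one-forms equality of HOL functions.\<close>

type_synonym 'a one_form = "'a vector_field \<Rightarrow> 'a \<Rightarrow> real"
type_synonym 'a two_tensor = "'a vector_field \<Rightarrow> 'a vector_field \<Rightarrow> 'a \<Rightarrow> real"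

definition restrict_vf ::
  "('a::{t2_space,second_countable_topology}, 'e::euclidean_space) chart set
     \<Rightarrow> 'a one_form \<Rightarrow> 'a one_form" where
  "restrict_vf A \<alpha> = (\<lambda>X. if X \<in> vector_fields A then \<alpha> X else (\<lambda>p. 0))"

definition one_forms ::
  "('a::{t2_space,second_countable_topology}, 'e::euclidean_space) chart set
     \<Rightarrow> 'a one_form set" where
  "one_forms A = {\<alpha>.
     (\<forall>X\<in>vector_fields A. \<alpha> X \<in> smooth_functions A) \<and>
     (\<forall>X\<in>vector_fields A. \<forall>Y\<in>vector_fields A. \<alpha> (vf_add X Y) = (\<lambda>p. \<alpha> X p + \<alpha> Y p)) \<and>
     (\<forall>\<phi>\<in>smooth_functions A. \<forall>X\<in>vector_fields A. \<alpha> (vf_scale \<phi> X) = (\<lambda>p. \<phi> p * \<alpha> X p)) \<and>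
     (\<forall>X. X \<notin> vector_fields A \<longrightarrow> \<alpha> X = (\<lambda>p. 0))}"

definition form_add :: "'a one_form \<Rightarrow> 'a one_form \<Rightarrow> 'a one_form" where
  "form_add \<alpha> \<beta> = (\<lambda>X p. \<alpha> X p + \<beta> X p)"

definition form_diff :: "'a one_form \<Rightarrow> 'a one_form \<Rightarrow> 'a one_form" where
  "form_diff \<alpha> \<beta> = (\<lambda>X p. \<alpha> X p - \<beta> X p)"

definition form_scale :: "('a \<Rightarrow> real) \<Rightarrow> 'a one_form \<Rightarrow> 'a one_form" where
  "form_scale \<phi> \<alpha> = (\<lambda>X p. \<phi> p * \<alpha> X p)"

definition endomorphism_field ::
  "('a::{t2_space,second_countable_topology}, 'e::euclidean_space) chart set
     \<Rightarrow> ('a vector_field \<Rightarrow> 'a vector_field) \<Rightarrow> bool" where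
  "endomorphism_field A \<Phi> \<longleftrightarrow>
     (\<forall>X\<in>vector_fields A. \<Phi> X \<in> vector_fields A) \<and>
     (\<forall>X\<in>vector_fields A. \<forall>Y\<in>vector_fields A. \<Phi> (vf_add X Y) = vf_add (\<Phi> X) (\<Phi> Y)) \<and>
     (\<forall>\<phi>\<in>smooth_functions A. \<forall>X\<in>vector_fields A. \<Phi> (vf_scale \<phi> X) = vf_scale \<phi> (\<Phi> X))"

text \<open>Given symmetry, linearity in the second argument suffices. The last clause says that the
  bilinear form is nondegenerate on each tangent space.\<close>

definition pseudo_riemannian_metric ::
  "('a::{t2_space,second_countable_topology}, 'e::euclidean_space) chart set
     \<Rightarrow> 'a two_tensor \<Rightarrow> bool" where
  "pseudo_riemannian_metric A g \<longleftrightarrow>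
     (\<forall>X\<in>vector_fields A. restrict_vf A (g X) \<in> one_forms A) \<and>
     (\<forall>X\<in>vector_fields A. \<forall>Y\<in>vector_fields A. g X Y = g Y X) \<and>
     (\<forall>p. \<forall>X\<in>vector_fields A.
        (\<forall>Y\<in>vector_fields A. g X Y p = 0) \<longrightarrow> X p = (\<lambda>f. 0))"


section \<open>Exterior calculus\<close>

definition d_fun ::
  "('a::{t2_space,second_countable_topology}, 'e::euclidean_space) chart set
     \<Rightarrow> ('a \<Rightarrow> real) \<Rightarrow> 'a one_form" where
  "d_fun A f = restrict_vf A (\<lambda>X. vf_apply X f)"

text \<open>The exterior derivative of a one-form, in the convention without a factor one half: the one
  for which \<open>L\<^sub>X = d i\<^sub>X + i\<^sub>X d\<close> holds with \<open>(i\<^sub>X \<omega>)(Y) = \<omega>(X,Y)\<close>.\<close>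

definition d_form :: "'a one_form \<Rightarrow> 'a two_tensor" where
  "d_form \<alpha> X Y =
     (\<lambda>p. X p (\<alpha> Y) - Y p (\<alpha> X) - \<alpha> (lie_bracket X Y) p)"

definition lie_form ::
  "('a::{t2_space,second_countable_topology}, 'e::euclidean_space) chart set
     \<Rightarrow> 'a vector_field \<Rightarrow> 'a one_form \<Rightarrow> 'a one_form" where
  "lie_form A X \<alpha> =
     restrict_vf A (\<lambda>Y p. X p (\<alpha> Y) - \<alpha> (lie_bracket X Y) p)"

text \<open>A \<open>k\<close>-form takes its arguments as a sequence of vector fields, of which only the entries
  with index less than \<open>k\<close> matter.\<close>

type_synonym 'a form = "(nat \<Rightarrow> 'a vector_field) \<Rightarrow> 'a \<Rightarrow> real"

definition wedge :: "nat \<Rightarrow> nat \<Rightarrow> 'a form \<Rightarrow> 'a form \<Rightarrow> 'a form" where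
  "wedge k l \<omega> \<tau> = (\<lambda>X p.
     (\<Sum>\<sigma> | \<sigma> permutes {..<k + l}.
        of_int (sign \<sigma>) * \<omega> (\<lambda>i. X (\<sigma> i)) p * \<tau> (\<lambda>i. X (\<sigma> (k + i))) p)
     / (fact k * fact l))"

fun wedge_power2 :: "'a form \<Rightarrow> nat \<Rightarrow> 'a form" where
  "wedge_power2 \<omega> 0 = (\<lambda>X p. 1)"
| "wedge_power2 \<omega> (Suc m) = wedge 2 (2 * m) \<omega> (wedge_power2 \<omega> m)"

text \<open>In a manifold of dimension \<open>m\<close>, an \<open>m\<close>-form is a volume form iff it vanishes nowhere.\<close>

definition volume_form ::
  "('a::{t2_space,second_countable_topology}, 'e::euclidean_space) chart set
     \<Rightarrow> 'a form \<Rightarrow> bool" where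
  "volume_form A \<omega> \<longleftrightarrow> (\<forall>p. \<exists>X. (\<forall>i. X i \<in> vector_fields A) \<and> \<omega> X p \<noteq> 0)"


section \<open>Contact forms and pseudo-Riemannian contact manifolds\<close>

definition contact_form ::
  "nat \<Rightarrow> ('a::{t2_space,second_countable_topology}, 'e::euclidean_space) chart set
     \<Rightarrow> 'a one_form \<Rightarrow> bool" where
  "contact_form n A \<eta> \<longleftrightarrow>
     n \<ge> 1 \<and> DIM('e) = 2 * n + 1 \<and> \<eta> \<in> one_forms A \<and>
     volume_form A
       (wedge 1 (2 * n) (\<lambda>X. \<eta> (X 0)) (wedge_power2 (\<lambda>X. d_form \<eta> (X 0) (X 1)) n))"

definition flat_eta ::
  "('a::{t2_space,second_countable_topology}, 'e::euclidean_space) chart set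
     \<Rightarrow> 'a one_form \<Rightarrow> 'a vector_field \<Rightarrow> 'a one_form" where
  "flat_eta A \<eta> X = restrict_vf A (\<lambda>Y p. - d_form \<eta> X Y p + \<eta> X p * \<eta> Y p)"

definition sharp_eta ::
  "('a::{t2_space,second_countable_topology}, 'e::euclidean_space) chart set
     \<Rightarrow> 'a one_form \<Rightarrow> 'a one_form \<Rightarrow> 'a vector_field" where
  "sharp_eta A \<eta> = inv_into (vector_fields A) (flat_eta A \<eta>)"

definition contact_bivector ::
  "('a::{t2_space,second_countable_topology}, 'e::euclidean_space) chart set
     \<Rightarrow> 'a one_form \<Rightarrow> 'a one_form \<Rightarrow> 'a one_form \<Rightarrow> 'a \<Rightarrow> real" where
  "contact_bivector A \<eta> \<alpha> \<beta> = d_form \<eta> (sharp_eta A \<eta> \<alpha>) (sharp_eta A \<eta> \<beta>)"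

definition reeb_field ::
  "('a::{t2_space,second_countable_topology}, 'e::euclidean_space) chart set
     \<Rightarrow> 'a one_form \<Rightarrow> 'a vector_field" where
  "reeb_field A \<eta> = sharp_eta A \<eta> \<eta>"

definition pseudo_riemannian_almost_contact ::
  "('a::{t2_space,second_countable_topology}, 'e::euclidean_space) chart set
     \<Rightarrow> ('a vector_field \<Rightarrow> 'a vector_field) \<Rightarrow> 'a vector_field \<Rightarrow> 'a one_form
     \<Rightarrow> 'a two_tensor \<Rightarrow> bool" where
  "pseudo_riemannian_almost_contact A \<Phi> \<xi> \<eta> g \<longleftrightarrow>
     endomorphism_field A \<Phi> \<and> \<xi> \<in> vector_fields A \<and> \<eta> \<in> one_forms A \<and>
     pseudo_riemannian_metric A g \<and>
     (\<forall>X\<in>vector_fields A. \<Phi> (\<Phi> X) = vf_diff (vf_scale (\<eta> X) \<xi>) X) \<and>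
     \<eta> \<xi> = (\<lambda>p. 1) \<and>
     (\<forall>X\<in>vector_fields A. \<forall>Y\<in>vector_fields A.
        g (\<Phi> X) (\<Phi> Y) = (\<lambda>p. g X Y p - \<eta> X p * \<eta> Y p))"

definition pseudo_riemannian_contact_manifold ::
  "nat \<Rightarrow> ('a::{t2_space,second_countable_topology}, 'e::euclidean_space) chart set
     \<Rightarrow> 'a one_form \<Rightarrow> 'a two_tensor \<Rightarrow> bool" where
  "pseudo_riemannian_contact_manifold n A \<eta> g \<longleftrightarrow>
     smooth_manifold A \<and> contact_form n A \<eta> \<and> pseudo_riemannian_metric A g \<and>
     (\<exists>\<Phi>. pseudo_riemannian_almost_contact A \<Phi> (reeb_field A \<eta>) \<eta> g \<and>
          (\<forall>X\<in>vector_fields A. \<forall>Y\<in>vector_fields A. g X (\<Phi> Y) = d_form \<eta> X Y))"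


section \<open>Connections and contravariant derivatives\<close>

definition is_levi_civita_connection ::
  "('a::{t2_space,second_countable_topology}, 'e::euclidean_space) chart set
     \<Rightarrow> 'a two_tensor \<Rightarrow> ('a vector_field \<Rightarrow> 'a vector_field \<Rightarrow> 'a vector_field) \<Rightarrow> bool" where
  "is_levi_civita_connection A g nabla \<longleftrightarrow>
     (\<forall>X\<in>vector_fields A. \<forall>Y\<in>vector_fields A. nabla X Y \<in> vector_fields A) \<and>
     (\<forall>X\<in>vector_fields A. \<forall>Y\<in>vector_fields A. \<forall>Z\<in>vector_fields A.
        nabla (vf_add X Y) Z = vf_add (nabla X Z) (nabla Y Z) \<and>
        nabla X (vf_add Y Z) = vf_add (nabla X Y) (nabla X Z)) \<and>
     (\<forall>\<phi>\<in>smooth_functions A. \<forall>X\<in>vector_fields A. \<forall>Y\<in>vector_fields A.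
        nabla (vf_scale \<phi> X) Y = vf_scale \<phi> (nabla X Y) \<and>
        nabla X (vf_scale \<phi> Y) =
          vf_add (vf_scale \<phi> (nabla X Y)) (vf_scale (vf_apply X \<phi>) Y)) \<and>
     (\<forall>X\<in>vector_fields A. \<forall>Y\<in>vector_fields A.
        vf_diff (nabla X Y) (nabla Y X) = lie_bracket X Y) \<and>
     (\<forall>X\<in>vector_fields A. \<forall>Y\<in>vector_fields A. \<forall>Z\<in>vector_fields A.
        vf_apply X (g Y Z) = (\<lambda>p. g (nabla X Y) Z p + g Y (nabla X Z) p))"

text \<open>In the following, \<open>\<pi>\<close> and \<open>\<xi>\<close> are an arbitrary bivector field (acting on one-forms) and vector
  field, \<open>g\<close> a metric.\<close>

type_synonym 'a bivector = "'a one_form \<Rightarrow> 'a one_form \<Rightarrow> 'a \<Rightarrow> real"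

definition sharp_pi ::
  "('a::{t2_space,second_countable_topology}, 'e::euclidean_space) chart set
     \<Rightarrow> 'a bivector \<Rightarrow> 'a one_form \<Rightarrow> 'a vector_field" where
  "sharp_pi A \<pi> \<alpha> = (THE X. X \<in> vector_fields A \<and> (\<forall>\<beta>\<in>one_forms A. \<beta> X = \<pi> \<alpha> \<beta>))"

definition sharp_pi_xi ::
  "('a::{t2_space,second_countable_topology}, 'e::euclidean_space) chart set
     \<Rightarrow> 'a bivector \<Rightarrow> 'a vector_field \<Rightarrow> 'a one_form \<Rightarrow> 'a vector_field" where
  "sharp_pi_xi A \<pi> \<xi> \<alpha> = vf_add (sharp_pi A \<pi> \<alpha>) (vf_scale (\<alpha> \<xi>) \<xi>)"

definition bracket_pi ::
  "('a::{t2_space,second_countable_topology}, 'e::euclidean_space) chart set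
     \<Rightarrow> 'a bivector \<Rightarrow> 'a one_form \<Rightarrow> 'a one_form \<Rightarrow> 'a one_form" where
  "bracket_pi A \<pi> \<alpha> \<beta> =
     form_diff (form_diff (lie_form A (sharp_pi A \<pi> \<alpha>) \<beta>) (lie_form A (sharp_pi A \<pi> \<beta>) \<alpha>))
       (d_fun A (\<pi> \<alpha> \<beta>))"

definition bracket_pi_xi ::
  "('a::{t2_space,second_countable_topology}, 'e::euclidean_space) chart set
     \<Rightarrow> 'a bivector \<Rightarrow> 'a vector_field \<Rightarrow> 'a one_form \<Rightarrow> 'a one_form \<Rightarrow> 'a one_form
     \<Rightarrow> 'a one_form" where
  "bracket_pi_xi A \<pi> \<xi> lam \<alpha> \<beta> =
     form_diff
       (form_diff
         (form_add (bracket_pi A \<pi> \<alpha> \<beta>) (form_scale (\<alpha> \<xi>) (form_diff (lie_form A \<xi> \<beta>) \<beta>)))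
         (form_scale (\<beta> \<xi>) (form_diff (lie_form A \<xi> \<alpha>) \<alpha>)))
       (form_scale (\<pi> \<alpha> \<beta>) lam)"

definition flat_g ::
  "('a::{t2_space,second_countable_topology}, 'e::euclidean_space) chart set
     \<Rightarrow> 'a two_tensor \<Rightarrow> 'a vector_field \<Rightarrow> 'a one_form" where
  "flat_g A g X = restrict_vf A (\<lambda>Y. g X Y)"

definition sharp_g ::
  "('a::{t2_space,second_countable_topology}, 'e::euclidean_space) chart set
     \<Rightarrow> 'a two_tensor \<Rightarrow> 'a one_form \<Rightarrow> 'a vector_field" where
  "sharp_g A g = inv_into (vector_fields A) (flat_g A g)"

definition cometric ::
  "('a::{t2_space,second_countable_topology}, 'e::euclidean_space) chart set
     \<Rightarrow> 'a two_tensor \<Rightarrow> 'a bivector" where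
  "cometric A g \<alpha> \<beta> = g (sharp_g A g \<alpha>) (sharp_g A g \<beta>)"

text \<open>The endomorphism field \<open>J\<close> with \<open>g(J \<sharp>\<^sub>g\<alpha>, \<sharp>\<^sub>g\<beta>) = \<pi>(\<alpha>,\<beta>)\<close>; its value at \<open>X\<close> is
  determined by this equation for the one-form \<open>\<alpha> = \<flat>\<^sub>g X\<close>.\<close>

definition J_field ::
  "('a::{t2_space,second_countable_topology}, 'e::euclidean_space) chart set
     \<Rightarrow> 'a bivector \<Rightarrow> 'a two_tensor \<Rightarrow> 'a vector_field \<Rightarrow> 'a vector_field" where
  "J_field A \<pi> g X =
     (THE Z. Z \<in> vector_fields A \<and>
        (\<forall>\<alpha>\<in>one_forms A. \<forall>\<beta>\<in>one_forms A. sharp_g A g \<alpha> = X \<longrightarrow> g Z (sharp_g A g \<beta>) = \<pi> \<alpha> \<beta>))"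

definition lambda_g ::
  "('a::{t2_space,second_countable_topology}, 'e::euclidean_space) chart set
     \<Rightarrow> 'a bivector \<Rightarrow> 'a vector_field \<Rightarrow> 'a two_tensor \<Rightarrow> 'a one_form" where
  "lambda_g A \<pi> \<xi> g =
     form_diff (form_scale (g \<xi> \<xi>) (flat_g A g \<xi>)) (flat_g A g (J_field A \<pi> g \<xi>))"

definition bracket_g ::
  "('a::{t2_space,second_countable_topology}, 'e::euclidean_space) chart set
     \<Rightarrow> 'a bivector \<Rightarrow> 'a vector_field \<Rightarrow> 'a two_tensor \<Rightarrow> 'a one_form \<Rightarrow> 'a one_form
     \<Rightarrow> 'a one_form" where
  "bracket_g A \<pi> \<xi> g = bracket_pi_xi A \<pi> \<xi> (lambda_g A \<pi> \<xi> g)"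

definition is_contravariant_derivative ::
  "('a::{t2_space,second_countable_topology}, 'e::euclidean_space) chart set
     \<Rightarrow> 'a bivector \<Rightarrow> 'a vector_field \<Rightarrow> ('a one_form \<Rightarrow> 'a one_form \<Rightarrow> 'a one_form) \<Rightarrow> bool" where
  "is_contravariant_derivative A \<pi> \<xi> D \<longleftrightarrow>
     (\<forall>\<alpha>\<in>one_forms A. \<forall>\<beta>\<in>one_forms A. D \<alpha> \<beta> \<in> one_forms A) \<and>
     (\<forall>\<alpha>\<in>one_forms A. \<forall>\<beta>\<in>one_forms A. \<forall>\<gamma>\<in>one_forms A.
        D (form_add \<alpha> \<beta>) \<gamma> = form_add (D \<alpha> \<gamma>) (D \<beta> \<gamma>) \<and>
        D \<alpha> (form_add \<beta> \<gamma>) = form_add (D \<alpha> \<beta>) (D \<alpha> \<gamma>)) \<and>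
     (\<forall>c. \<forall>\<alpha>\<in>one_forms A. \<forall>\<beta>\<in>one_forms A.
        D (form_scale (\<lambda>p. c) \<alpha>) \<beta> = form_scale (\<lambda>p. c) (D \<alpha> \<beta>) \<and>
        D \<alpha> (form_scale (\<lambda>p. c) \<beta>) = form_scale (\<lambda>p. c) (D \<alpha> \<beta>)) \<and>
     (\<forall>\<phi>\<in>smooth_functions A. \<forall>\<alpha>\<in>one_forms A. \<forall>\<beta>\<in>one_forms A.
        D (form_scale \<phi> \<alpha>) \<beta> = form_scale \<phi> (D \<alpha> \<beta>) \<and>
        D \<alpha> (form_scale \<phi> \<beta>) =
          form_add (form_scale \<phi> (D \<alpha> \<beta>)) (form_scale (vf_apply (sharp_pi_xi A \<pi> \<xi> \<alpha>) \<phi>) \<beta>))"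

definition is_contravariant_levi_civita ::
  "('a::{t2_space,second_countable_topology}, 'e::euclidean_space) chart set
     \<Rightarrow> 'a bivector \<Rightarrow> 'a vector_field \<Rightarrow> 'a two_tensor
     \<Rightarrow> ('a one_form \<Rightarrow> 'a one_form \<Rightarrow> 'a one_form) \<Rightarrow> bool" where
  "is_contravariant_levi_civita A \<pi> \<xi> g D \<longleftrightarrow>
     is_contravariant_derivative A \<pi> \<xi> D \<and>
     (\<forall>\<alpha>\<in>one_forms A. \<forall>\<beta>\<in>one_forms A.
        form_diff (D \<alpha> \<beta>) (D \<beta> \<alpha>) = bracket_g A \<pi> \<xi> g \<alpha> \<beta>) \<and>
     (\<forall>\<alpha>\<in>one_forms A. \<forall>\<beta>\<in>one_forms A. \<forall>\<gamma>\<in>one_forms A.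
        vf_apply (sharp_pi_xi A \<pi> \<xi> \<alpha>) (cometric A g \<beta> \<gamma>) =
          (\<lambda>p. cometric A g (D \<alpha> \<beta>) \<gamma> p + cometric A g \<beta> (D \<alpha> \<gamma>) p))"

end

theory Submission
  imports Defs
begin

text \<open>The map \<open>\<flat>\<^sub>\<eta>\<close> carries every piece of the contravariant geometry to the corresponding piece of
  the ordinary geometry of \<open>g\<close>. The axioms of an almost contact structure give \<open>\<Phi> \<xi> = 0\<close>,
  \<open>\<eta> \<circ> \<Phi> = 0\<close> and \<open>\<flat>\<^sub>g \<xi> = \<eta>\<close>, and then \<open>\<flat>\<^sub>\<eta> = \<flat>\<^sub>g \<circ> T\<close> with the isometry
  \<open>T = \<Phi> + \<eta> \<otimes> \<xi>\<close>. Hence the cometric becomes the metric (\<open>cometric_flat\<close>), the anchor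
  \<open>\<sharp>\<^sub>\<pi>\<^sub>,\<^sub>\<xi>\<close> becomes the identity (\<open>sharp_pi_xi_flat\<close>), the form \<open>\<lambda>\<close> is \<open>\<eta>\<close> itself
  (\<open>lambda_g_eq\<close>), and the bracket of one-forms becomes the Lie bracket (\<open>bracket_g_flat\<close>, a
  consequence of \<open>d(d\<eta>) = 0\<close>). So \<open>\<sharp>\<^sub>\<eta> \<D>\<close>, read on vector fields, is torsion-free and metric, as
  is \<open>\<nabla>\<close>, and two such operations agree (\<open>torsion_free_metric_unique\<close>).

  All of this needs \<open>\<flat>\<^sub>\<eta>\<close>, equivalently \<open>\<flat>\<^sub>g\<close>, to be a bijection from vector fields to one-forms.
  Injectivity is the nondegeneracy of \<open>g\<close>; surjectivity (\<open>flat_g_surj\<close>) is where the manifold enters.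
  Vector fields are derivations and one-forms are linear maps over the smooth functions, so it has
  to be shown first that both are pointwise objects with finitely many smooth components: Hadamard's
  lemma expands a derivation in coordinates (\<open>tangent_in_coordinates\<close>), and bump functions make
  coordinates and coordinate fields global (\<open>local_frame_exists\<close>). The components of the field that
  represents a one-form then solve a linear system with smooth coefficients; solving it without
  division (\<open>smooth_linear_system\<close>) yields global solutions up to a nonvanishing factor, and these
  can be glued by dividing by that factor.\<close>

section \<open>Calculus of differentiability classes\<close>

lemma Ck_on_cong:
  assumes "open S" "\<And>x. x \<in> S \<Longrightarrow> f x = g x" "Ck_on k S f"
  shows "Ck_on k S g"
  using assms(2,3)
proof (induction k arbitrary: f g)
  case 0
  then show ?case using continuous_on_cong by fastforce
next
  case (Suc k)
  have D: "(g has_derivative frechet_derivative f (at x)) (at x)" if "x \<in> S" for x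
  proof -
    have "(f has_derivative frechet_derivative f (at x)) (at x)"
      using Suc.prems(2) that frechet_derivative_works by auto
    then show ?thesis
      by (rule has_derivative_transform_within_open[OF _ assms(1) that Suc.prems(1)])
  qed
  have E: "frechet_derivative f (at x) = frechet_derivative g (at x)" if "x \<in> S" for x
    using frechet_derivative_at[OF D[OF that]] .
  have "Ck_on k S (\<lambda>x. frechet_derivative g (at x) v)" for v
    by (rule Suc.IH[of "\<lambda>x. frechet_derivative f (at x) v"]) (use E Suc.prems(2) in auto)
  then show ?case using D by (auto simp: differentiable_def)
qed

text \<open>The recursion for \<open>Ck_on\<close> speaks of \<open>frechet_derivative\<close>, a choice of derivative. This rule allows
  any known derivative to be used on an open set, so that the usual differentiation rules apply.\<close>

lemma Ck_on_SucI:
  assumes "open S" "\<And>x. x \<in> S \<Longrightarrow> (f has_derivative f' x) (at x)"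
    and "\<And>v. Ck_on k S (\<lambda>x. f' x v)"
  shows "Ck_on (Suc k) S f"
proof -
  have "f' x v = frechet_derivative f (at x) v" if "x \<in> S" for x v
    using frechet_derivative_at[OF assms(2)[OF that]] by simp
  then have "Ck_on k S (\<lambda>x. frechet_derivative f (at x) v)" for v
    using Ck_on_cong[OF assms(1) _ assms(3)[of v]] by simp
  then show ?thesis using assms(2) by (auto simp: differentiable_def)
qed

lemma Ck_on_SucD:
  assumes "Ck_on (Suc k) S f" "x \<in> S"
  shows "(f has_derivative frechet_derivative f (at x)) (at x)"
  using assms frechet_derivative_works by auto

lemma Ck_on_Suc_imp: "Ck_on (Suc k) S f \<Longrightarrow> Ck_on k S f"
proof (induction k arbitrary: f)
  case 0
  then show ?case
    by (auto intro!: continuous_at_imp_continuous_on differentiable_imp_continuous_within)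
next
  case (Suc k)
  have "Ck_on (Suc k) S (\<lambda>x. frechet_derivative f (at x) v)" for v
    using Suc.prems unfolding Ck_on.simps(2)[of "Suc k"] by blast
  then show ?case using Suc.IH Suc.prems by (metis Ck_on.simps(2))
qed

lemma Ck_on_subset: "Ck_on k S f \<Longrightarrow> T \<subseteq> S \<Longrightarrow> Ck_on k T f"
proof (induction k arbitrary: f)
  case 0
  then show ?case using continuous_on_subset by auto
qed auto

lemma Ck_on_local:
  assumes "\<And>x. x \<in> S \<Longrightarrow> \<exists>N. open N \<and> x \<in> N \<and> Ck_on k N f"
  shows "Ck_on k S f"
  using assms
proof (induction k arbitrary: f)
  case 0
  then show ?case
    by (auto intro!: continuous_at_imp_continuous_on simp: continuous_on_eq_continuous_at) 
      (metis continuous_on_eq_continuous_at)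
next
  case (Suc k)
  have "f differentiable (at x)" if "x \<in> S" for x
    using Suc.prems[OF that] by auto
  moreover have "Ck_on k S (\<lambda>x. frechet_derivative f (at x) v)" for v
    by (rule Suc.IH) (use Suc.prems in fastforce)
  ultimately show ?case by simp
qed

lemma Ck_on_const: "open S \<Longrightarrow> Ck_on k S (\<lambda>x. c)"
proof (induction k arbitrary: c)
  case (Suc k)
  show ?case by (rule Ck_on_SucI[OF Suc.prems, where f' = "\<lambda>x v. 0"]) (use Suc in auto)
qed auto

lemma Ck_on_bounded_linear:
  assumes "bounded_linear L" "open S" "Ck_on k S f"
  shows "Ck_on k S (\<lambda>x. L (f x))"
  using assms(3)
proof (induction k arbitrary: f)
  case 0
  then show ?case using bounded_linear.continuous_on[OF assms(1)] by auto
next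
  case (Suc k)
  show ?case
    by (rule Ck_on_SucI[OF assms(2) bounded_linear.has_derivative[OF assms(1) Ck_on_SucD[OF Suc.prems]]])
       (use Suc in auto)
qed

lemma Ck_on_ident: "open S \<Longrightarrow> Ck_on k S (\<lambda>x. x)"
  by (cases k) (auto intro!: Ck_on_SucI[where f' = "\<lambda>x v. v"] Ck_on_const)

lemma Ck_on_add:
  assumes "open S" "Ck_on k S f" "Ck_on k S g"
  shows "Ck_on k S (\<lambda>x. f x + g x)"
  using assms(2,3)
proof (induction k arbitrary: f g)
  case 0
  then show ?case by (auto intro: continuous_intros)
next
  case (Suc k)
  show ?case
    by (rule Ck_on_SucI[OF assms(1) has_derivative_add[OF Ck_on_SucD[OF Suc.prems(1)] Ck_on_SucD[OF Suc.prems(2)]]])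
       (use Suc in auto)
qed

lemma Ck_on_sum:
  assumes "open S" "\<And>i. i \<in> I \<Longrightarrow> Ck_on k S (f i)"
  shows "Ck_on k S (\<lambda>x. \<Sum>i\<in>I. f i x)"
  using assms(2)
  by (induction I rule: infinite_finite_induct) (auto intro!: Ck_on_const Ck_on_add assms(1))

lemma Ck_on_mult:
  fixes f g :: "'e::euclidean_space \<Rightarrow> real"
  assumes "open S" "Ck_on k S f" "Ck_on k S g"
  shows "Ck_on k S (\<lambda>x. f x * g x)"
  using assms(2,3)
proof (induction k arbitrary: f g)
  case 0
  then show ?case by (auto intro: continuous_intros)
next
  case (Suc k)
  have *: "Ck_on k S f" "Ck_on k S g" using Suc.prems Ck_on_Suc_imp by blast+
  show ?case
    by (rule Ck_on_SucI[OF assms(1) has_derivative_mult[OF Ck_on_SucD[OF Suc.prems(1)] Ck_on_SucD[OF Suc.prems(2)]]])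
       (use Suc * in \<open>auto intro!: Ck_on_add Suc.IH assms(1)\<close>)
qed

lemma Ck_on_inverse:
  fixes f :: "'e::euclidean_space \<Rightarrow> real"
  assumes "open S" "Ck_on k S f" "\<And>x. x \<in> S \<Longrightarrow> f x \<noteq> 0"
  shows "Ck_on k S (\<lambda>x. inverse (f x))"
  using assms(2)
proof (induction k)
  case 0
  then show ?case using assms(3) by (auto intro: continuous_intros)
next
  case (Suc k)
  have *: "Ck_on k S (\<lambda>x. inverse (f x))" using Suc Ck_on_Suc_imp by blast
  have D: "Ck_on k S (\<lambda>x. frechet_derivative f (at x) v)" for v using Suc.prems by auto
  have "Ck_on k S (\<lambda>x. (- 1) * (inverse (f x) * frechet_derivative f (at x) v * inverse (f x)))" for v
    by (intro Ck_on_mult Ck_on_const assms(1) * D)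
  then show ?case
    by (intro Ck_on_SucI[OF assms(1) Deriv.has_derivative_inverse[OF assms(3) Ck_on_SucD[OF Suc.prems]]]) auto
qed

text \<open>The chain rule, with the outer derivative expanded in the standard basis: its partial
  derivatives are again functions composed with \<open>f\<close>, to which the induction hypothesis applies.\<close>

lemma Ck_on_compose:
  fixes f :: "'e::euclidean_space \<Rightarrow> 'f::euclidean_space" and u :: "'f \<Rightarrow> real"
  assumes "open S" "open T" "f ` S \<subseteq> T" "Ck_on k S f" "Ck_on k T u"
  shows "Ck_on k S (\<lambda>x. u (f x))"
  using assms(4,5)
proof (induction k arbitrary: u)
  case 0
  then show ?case using assms(3) by (auto intro: continuous_on_compose2)
next
  case (Suc k)
  let ?f = "\<lambda>x. frechet_derivative f (at x)" and ?u = "\<lambda>y. frechet_derivative u (at y)"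
  have D: "((\<lambda>x. u (f x)) has_derivative (\<lambda>v. \<Sum>i\<in>Basis. (?f x v \<bullet> i) * ?u (f x) i)) (at x)"
    if "x \<in> S" for x
  proof -
    have u: "(u has_derivative ?u (f x)) (at (f x))"
      by (rule Ck_on_SucD[OF Suc.prems(2)]) (use that assms(3) in auto)
    have C: "((\<lambda>x. u (f x)) has_derivative (\<lambda>v. ?u (f x) (?f x v))) (at x)"
      using has_derivative_compose[OF Ck_on_SucD[OF Suc.prems(1) that] u] .
    have R: "?u (f x) w = (\<Sum>i\<in>Basis. (w \<bullet> i) * ?u (f x) i)" for w
    proof -
      interpret linear "?u (f x)" using u has_derivative_linear by blast
      have "?u (f x) w = ?u (f x) (\<Sum>i\<in>Basis. (w \<bullet> i) *\<^sub>R i)" by (simp add: euclidean_representation)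
      then show ?thesis by (simp add: sum scale)
    qed
    show ?thesis by (rule has_derivative_eq_rhs[OF C ext[OF R]])
  qed
  have IH: "Ck_on k S (\<lambda>x. ?u (f x) i)" for i
    by (rule Suc.IH) (use Suc.prems Ck_on_Suc_imp in auto)
  have F: "Ck_on k S (\<lambda>x. ?f x v \<bullet> i)" for v i
    by (rule Ck_on_bounded_linear[OF bounded_linear_inner_left assms(1)]) (use Suc.prems in auto)
  show ?case
    by (rule Ck_on_SucI[OF assms(1) D]) (auto intro!: Ck_on_sum Ck_on_mult assms(1) IH F)
qed

lemma smooth_on_cong: "open S \<Longrightarrow> (\<And>x. x \<in> S \<Longrightarrow> f x = g x) \<Longrightarrow> smooth_on S f \<Longrightarrow> smooth_on S g"
  unfolding smooth_on_def using Ck_on_cong[of S f g] by simp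

lemma smooth_on_subset: "smooth_on S f \<Longrightarrow> T \<subseteq> S \<Longrightarrow> smooth_on T f"
  using Ck_on_subset[of _ S f T] by (simp add: smooth_on_def)

lemma smooth_on_local:
  "(\<And>x. x \<in> S \<Longrightarrow> \<exists>N. open N \<and> x \<in> N \<and> smooth_on N f) \<Longrightarrow> smooth_on S f"
  unfolding smooth_on_def by (intro allI Ck_on_local) blast

lemma smooth_on_const: "open S \<Longrightarrow> smooth_on S (\<lambda>x. c)"
  by (simp add: smooth_on_def Ck_on_const)

lemma smooth_on_inner: "open S \<Longrightarrow> smooth_on S (\<lambda>x. x \<bullet> i)"
  by (simp add: smooth_on_def Ck_on_bounded_linear[OF bounded_linear_inner_left] Ck_on_ident)

lemma smooth_on_add: "open S \<Longrightarrow> smooth_on S f \<Longrightarrow> smooth_on S g \<Longrightarrow> smooth_on S (\<lambda>x. f x + g x)"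
  by (simp add: smooth_on_def Ck_on_add)

lemma smooth_on_sum:
  "open S \<Longrightarrow> (\<And>i. i \<in> I \<Longrightarrow> smooth_on S (f i)) \<Longrightarrow> smooth_on S (\<lambda>x. \<Sum>i\<in>I. f i x)"
  by (simp add: smooth_on_def Ck_on_sum)

lemma smooth_on_mult:
  fixes f g :: "'e::euclidean_space \<Rightarrow> real"
  shows "open S \<Longrightarrow> smooth_on S f \<Longrightarrow> smooth_on S g \<Longrightarrow> smooth_on S (\<lambda>x. f x * g x)"
  by (simp add: smooth_on_def Ck_on_mult)

lemma smooth_on_diff:
  fixes f g :: "'e::euclidean_space \<Rightarrow> real"
  assumes "open S" "smooth_on S f" "smooth_on S g"
  shows "smooth_on S (\<lambda>x. f x - g x)"
  using smooth_on_add[OF assms(1,2) smooth_on_mult[OF assms(1) smooth_on_const[OF assms(1), of "-1"] assms(3)]]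
  by simp

lemma smooth_on_inverse:
  fixes f :: "'e::euclidean_space \<Rightarrow> real"
  shows "open S \<Longrightarrow> smooth_on S f \<Longrightarrow> (\<And>x. x \<in> S \<Longrightarrow> f x \<noteq> 0) \<Longrightarrow> smooth_on S (\<lambda>x. inverse (f x))"
  by (simp add: smooth_on_def Ck_on_inverse)

lemma smooth_on_compose:
  fixes f :: "'e::euclidean_space \<Rightarrow> 'f::euclidean_space" and u :: "'f \<Rightarrow> real"
  shows "open S \<Longrightarrow> open T \<Longrightarrow> f ` S \<subseteq> T \<Longrightarrow> smooth_on S f \<Longrightarrow> smooth_on T u \<Longrightarrow> smooth_on S (\<lambda>x. u (f x))"
  unfolding smooth_on_def by (intro allI Ck_on_compose[of S T]) auto

lemma smooth_on_has_derivative: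
  "smooth_on S f \<Longrightarrow> x \<in> S \<Longrightarrow> (f has_derivative frechet_derivative f (at x)) (at x)"
  unfolding smooth_on_def by (rule Ck_on_SucD[of 0]) blast+

lemma smooth_on_frechet_derivative:
  "smooth_on S f \<Longrightarrow> smooth_on S (\<lambda>x. frechet_derivative f (at x) v)"
  unfolding smooth_on_def by (metis Ck_on.simps(2))

lemma smooth_on_imp_continuous_on: "smooth_on S f \<Longrightarrow> continuous_on S f"
  unfolding smooth_on_def by (metis Ck_on.simps(1))

section \<open>Bump functions\<close>

text \<open>The function \<open>exp (-1/t)\<close>, continued by \<open>0\<close> to \<open>t \<le> 0\<close>, is smooth at \<open>0\<close>. The powers of \<open>1/t\<close>
  are there for the induction: the linear span of the family is closed under differentiation, so
  that it suffices to show that each member has a derivative.\<close>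

definition flat_exp :: "nat \<Rightarrow> real \<Rightarrow> real" where
  "flat_exp m t = (if t \<le> 0 then 0 else inverse t ^ m * exp (- inverse t))"

lemma flat_exp_tendsto_0: "(flat_exp m \<longlongrightarrow> 0) (at 0)"
proof -
  have "((\<lambda>s. s ^ m / exp s) \<longlongrightarrow> 0) (at_top :: real filter)"
    by (rule tendsto_power_div_exp_0)
  then have "((\<lambda>t. inverse t ^ m / exp (inverse t)) \<longlongrightarrow> (0::real)) (at_right 0)"
    by (rule filterlim_compose[OF _ filterlim_inverse_at_top_right])
  moreover have "eventually (\<lambda>t. inverse t ^ m / exp (inverse t) = flat_exp m t) (at_right (0::real))"
    by (auto simp: eventually_at_filter flat_exp_def exp_minus field_simps)
  ultimately have R: "(flat_exp m \<longlongrightarrow> 0) (at_right 0)"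
    by (rule Lim_transform_eventually)
  have "(flat_exp m \<longlongrightarrow> 0) (at_left 0)"
    by (rule Lim_transform_eventually[OF tendsto_const])
       (auto simp: eventually_at_filter flat_exp_def)
  with R show ?thesis by (simp add: filterlim_split_at)
qed

lemma flat_exp_has_derivative:
  "(flat_exp m has_field_derivative (flat_exp (m + 2) t - real m * flat_exp (m + 1) t)) (at t)"
proof -
  consider "t < 0" | "t > 0" | "t = 0" by linarith
  then show ?thesis
  proof cases
    case 1
    have "(flat_exp m has_field_derivative 0) (at t)"
      by (rule has_field_derivative_transform_within_open[where S = "{..<0}", OF DERIV_const[of 0]])
         (use 1 in \<open>auto simp: flat_exp_def\<close>)
    then show ?thesis using 1 by (simp add: flat_exp_def)
  next
    case 2
    have I: "(inverse has_field_derivative - (inverse t * inverse t)) (at t)"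
      using DERIV_inverse[of t UNIV] 2 by (simp add: power2_eq_square)
    have P: "((\<lambda>t. inverse t ^ m) has_field_derivative - (real m * inverse t ^ (m + 1))) (at t)"
      using DERIV_power[OF I, of m] by (cases m) (simp_all add: algebra_simps)
    have E: "((\<lambda>t. exp (- inverse t)) has_field_derivative exp (- inverse t) * (inverse t * inverse t)) (at t)"
      using DERIV_chain2[OF DERIV_exp DERIV_minus[OF I]] by simp
    have "((\<lambda>t. inverse t ^ m * exp (- inverse t)) has_field_derivative
        (flat_exp (m + 2) t - real m * flat_exp (m + 1) t)) (at t)"
      by (rule DERIV_cong[OF DERIV_mult[OF P E]]) (use 2 in \<open>simp add: flat_exp_def algebra_simps\<close>)
    then show ?thesis
      by (rule has_field_derivative_transform_within_open[where S = "{0<..}"])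
         (use 2 in \<open>auto simp: flat_exp_def\<close>)
  next
    case 3
    have "(flat_exp m y - flat_exp m 0) / (y - 0) = flat_exp (m + 1) y" for y
      by (auto simp: flat_exp_def field_simps)
    then show ?thesis
      using flat_exp_tendsto_0[of "m + 1"] 3
      by (simp add: has_field_derivative_iff flat_exp_def[of _ 0])
  qed
qed

lemma smooth_on_flat_exp: "smooth_on UNIV (flat_exp m)"
proof -
  have "Ck_on k UNIV (flat_exp m)" for k
  proof (induction k arbitrary: m)
    case 0
    show ?case
      using DERIV_isCont[OF flat_exp_has_derivative] by (auto intro: continuous_at_imp_continuous_on)
  next
    case (Suc k)
    have "Ck_on k UNIV (\<lambda>t. (flat_exp (m + 2) t + (- real m) * flat_exp (m + 1) t) * v)" for v
      by (intro Ck_on_mult Ck_on_add Ck_on_const Suc) auto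
    then show ?case
      by (intro Ck_on_SucI[OF _ flat_exp_has_derivative[unfolded has_field_derivative_def]]) auto
  qed
  then show ?thesis by (simp add: smooth_on_def)
qed

text \<open>The quotient \<open>F / (F + G)\<close>, where \<open>F\<close> is positive exactly inside the large ball and \<open>G\<close>
  exactly outside the closed small one, so that the denominator has no zero.\<close>

lemma bump_function_exists:
  fixes a :: "'e::euclidean_space"
  assumes "0 < r" "r < R"
  obtains b :: "'e \<Rightarrow> real" where "smooth_on UNIV b"
    "\<And>y. y \<in> cball a r \<Longrightarrow> b y = 1" "\<And>y. y \<notin> ball a R \<Longrightarrow> b y = 0"
proof -
  define N where "N y = (\<Sum>i\<in>Basis. (y \<bullet> i - a \<bullet> i) * (y \<bullet> i - a \<bullet> i))" for y
  have N: "N y = (dist a y)\<^sup>2" for y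
  proof -
    have "N y = (y - a) \<bullet> (y - a)"
unfolding N_def
      by (subst euclidean_inner, rule sum.cong) (simp_all add: inner_diff_left[of y a])
    then show ?thesis by (simp add: dist_commute[of a y] dist_norm[of y a] power2_norm_eq_inner)
  qed
  have Ns: "smooth_on UNIV N"
    unfolding N_def by (intro smooth_on_sum smooth_on_mult smooth_on_diff smooth_on_inner smooth_on_const) auto
  define F where "F y = flat_exp 0 (R\<^sup>2 - N y)" for y
  define G where "G y = flat_exp 0 (N y - r\<^sup>2)" for y
  have "smooth_on UNIV F" "smooth_on UNIV G" unfolding F_def G_def
    by (rule smooth_on_compose[OF _ _ _ _ smooth_on_flat_exp]; auto intro!: smooth_on_diff smooth_on_const Ns)+
  moreover have pos: "F y + G y > 0" for y
  proof -
    have "r\<^sup>2 < R\<^sup>2" using assms by (simp add: power_strict_mono)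
    then have "N y < R\<^sup>2 \<or> r\<^sup>2 < N y" by linarith
    then show ?thesis unfolding F_def G_def flat_exp_def
      by (auto simp: add_nonneg_pos add_pos_nonneg add_pos_pos)
  qed
  ultimately have "smooth_on UNIV (\<lambda>y. F y * inverse (F y + G y))"
    by (intro smooth_on_mult smooth_on_inverse smooth_on_add) (auto simp: less_imp_neq[symmetric])
  moreover have "F y * inverse (F y + G y) = 1" if "y \<in> cball a r" for y
  proof -
    have "N y \<le> r\<^sup>2" using that by (simp add: N power_mono)
    then have "G y = 0" by (simp add: G_def flat_exp_def)
    then show ?thesis using pos[of y] by simp
  qed
  moreover have "F y * inverse (F y + G y) = 0" if "y \<notin> ball a R" for y
  proof -
    have "N y \<ge> R\<^sup>2" using that assms by (simp add: N power_mono)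
    then show ?thesis by (simp add: F_def flat_exp_def)
  qed
  ultimately show ?thesis using that by blast
qed

section \<open>Hadamard's lemma\<close>

lemma ray_in_ball:
  fixes a x :: "'e::euclidean_space"
  assumes "x \<in> ball a r" "t \<in> {0..1}"
  shows "a + t *\<^sub>R (x - a) \<in> ball a r"
proof -
  have "dist a (a + t *\<^sub>R (x - a)) = t * dist a x" using assms by (simp add: dist_norm norm_minus_commute[of a x])
  also have "\<dots> \<le> dist a x" using assms by (simp add: mult_left_le_one_le)
  finally show ?thesis using assms by simp
qed

text \<open>Differentiation under the integral sign. Each derivative in \<open>x\<close> produces a factor \<open>t\<close> and
  replaces \<open>G\<close> by a directional derivative; with the weight \<open>t ^ m\<close> the statement reproduces itself
  and is proved by induction on the order of differentiability.\<close>

lemma smooth_on_ray_integral: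
  fixes G :: "'e::euclidean_space \<Rightarrow> real"
  assumes "smooth_on (ball a r) G"
  shows "smooth_on (ball a r) (\<lambda>x. integral {0..1} (\<lambda>t. t ^ m * G (a + t *\<^sub>R (x - a))))"
proof -
  note ray = ray_in_ball[of _ a r]
  have cont: "continuous_on (ball a r \<times> {0..1}) (\<lambda>(x, t). t ^ m * G (a + t *\<^sub>R (x - a)))"
    if "continuous_on (ball a r) G" for G :: "'e \<Rightarrow> real" and m
    unfolding case_prod_beta
    by (intro continuous_intros continuous_on_compose2[OF that]) (use ray in auto)
  have int: "(\<lambda>t. t ^ m * G (a + t *\<^sub>R (x - a))) integrable_on {0..1}"
    if "continuous_on (ball a r) G" "x \<in> ball a r" for G :: "'e \<Rightarrow> real" and m x
    by (intro integrable_continuous_real continuous_intros continuous_on_compose2[OF that(1)])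
       (use ray that in auto)
  have "Ck_on k (ball a r) (\<lambda>x. integral {0..1} (\<lambda>t. t ^ m * G (a + t *\<^sub>R (x - a))))" for k
    using assms
  proof (induction k arbitrary: m G)
    case 0
    have "continuous_on (ball a r) (\<lambda>x. integral (cbox 0 1) (\<lambda>t. t ^ m * G (a + t *\<^sub>R (x - a))))"
      using cont[OF smooth_on_imp_continuous_on[OF 0], of m]
      by (intro integral_continuous_on_param) (simp add: case_prod_beta)
    then show ?case by simp
  next
    case (Suc k)
    define D where "D x v = frechet_derivative G (at x) v" for x v
    have D: "(G has_derivative D x) (at x)" if "x \<in> ball a r" for x
      using smooth_on_has_derivative[OF Suc.prems that] by (simp add: D_def[abs_def])
    have Ds: "smooth_on (ball a r) (\<lambda>x. D x v)" for v
      unfolding D_def by (rule smooth_on_frechet_derivative[OF Suc.prems])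
    define L where "L x t = Blinfun (\<lambda>v. t ^ Suc m * D (a + t *\<^sub>R (x - a)) v)" for x and t :: real
    have L: "blinfun_apply (L x t) v = t ^ Suc m * D (a + t *\<^sub>R (x - a)) v"
      if "x \<in> ball a r" "t \<in> {0..1}" for x t v
      unfolding L_def
      by (subst bounded_linear_Blinfun_apply)
         (auto intro!: bounded_linear_const_mult has_derivative_bounded_linear[OF D[OF ray[OF that]]])
    have leib: "((\<lambda>x. integral (cbox 0 1) (\<lambda>t. t ^ m * G (a + t *\<^sub>R (x - a)))) has_derivative
        integral (cbox 0 1) (L x)) (at x within ball a r)" if x: "x \<in> ball a r" for x
    proof (rule leibniz_rule)
      fix y t assume y: "y \<in> ball a r" and t: "t \<in> cbox 0 (1::real)"
      have "((\<lambda>y. t ^ m * G (a + t *\<^sub>R (y - a))) has_derivative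
          (\<lambda>v. t ^ m * D (a + t *\<^sub>R (y - a)) (t *\<^sub>R v))) (at y within ball a r)"
        by (rule has_derivative_mult_right, rule has_derivative_compose[OF _ D])
           (use ray y t in \<open>auto intro!: derivative_eq_intros\<close>)
      moreover have "t ^ m * D (a + t *\<^sub>R (y - a)) (t *\<^sub>R v) = L y t v" for v
        using L[of y t v] y t linear_cmul[OF has_derivative_linear[OF D[OF ray[of y t]]], of t v]
        by simp
      ultimately show "((\<lambda>y. t ^ m * G (a + t *\<^sub>R (y - a))) has_derivative L y t) (at y within ball a r)"
        by simp
    next
      show "(\<lambda>t. t ^ m * G (a + t *\<^sub>R (y - a))) integrable_on cbox 0 1" if "y \<in> ball a r" for y
        using int[OF smooth_on_imp_continuous_on[OF Suc.prems] that] by simp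
      show "continuous_on (ball a r \<times> cbox 0 1) (\<lambda>(x, t). L x t)"
      proof (rule continuous_on_blinfun_componentwise)
        fix i :: 'e assume "i \<in> Basis"
        have "continuous_on (ball a r \<times> {0..1}) (\<lambda>(x, t). t ^ Suc m * D (a + t *\<^sub>R (x - a)) i)"
          by (rule cont[OF smooth_on_imp_continuous_on[OF Ds]])
        then show "continuous_on (ball a r \<times> cbox 0 1) (\<lambda>x. blinfun_apply (case x of (x, t) \<Rightarrow> L x t) i)"
          by (rule continuous_on_cong[THEN iffD1, rotated 2]) (auto simp: L)
      qed
      show "x \<in> ball a r" by (rule x)
      show "convex (ball a r)" by (rule convex_ball)
    qed
    have der: "((\<lambda>x. integral {0..1} (\<lambda>t. t ^ m * G (a + t *\<^sub>R (x - a)))) has_derivative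
        integral {0..1} (L x)) (at x)" if "x \<in> ball a r" for x
      using leib[OF that] unfolding at_within_open[OF that open_ball] by simp
    have comp: "blinfun_apply (integral {0..1} (L x)) v =
        integral {0..1} (\<lambda>t. t ^ Suc m * D (a + t *\<^sub>R (x - a)) v)" if "x \<in> ball a r" for x v
    proof -
      have "continuous_on {0..1} (L x)"
      proof (rule continuous_on_blinfun_componentwise)
        fix i :: 'e
        have "continuous_on {0..1} (\<lambda>t. t ^ Suc m * D (a + t *\<^sub>R (x - a)) i)"
          by (intro continuous_intros continuous_on_compose2[OF smooth_on_imp_continuous_on[OF Ds]])
             (use ray that in auto)
        then show "continuous_on {0..1} (\<lambda>t. blinfun_apply (L x t) i)"
          by (rule continuous_on_cong[THEN iffD1, rotated 2]) (use that in \<open>auto simp: L\<close>)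
      qed
      then have "integral {0..1} (\<lambda>t. blinfun_apply (L x t) v) = blinfun_apply (integral {0..1} (L x)) v"
        using integral_linear[OF integrable_continuous_real blinfun.bounded_linear_left[of v]]
        by (simp add: o_def)
      moreover have "integral {0..1} (\<lambda>t. blinfun_apply (L x t) v) =
          integral {0..1} (\<lambda>t. t ^ Suc m * D (a + t *\<^sub>R (x - a)) v)"
        by (rule integral_cong) (use that in \<open>simp add: L\<close>)
      ultimately show ?thesis by simp
    qed
    show ?case
    proof (rule Ck_on_SucI[OF open_ball der])
      fix v
      show "Ck_on k (ball a r) (\<lambda>x. blinfun_apply (integral {0..1} (L x)) v)"
        by (rule Ck_on_cong[OF open_ball _ Suc.IH[OF Ds, of "Suc m" v]]) (simp add: comp)
    qed
  qed
  then show ?thesis by (simp add: smooth_on_def)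
qed

text \<open>Apply the fundamental theorem of calculus to \<open>F\<close> along the ray from \<open>a\<close> to \<open>x\<close>. The essential
  point is that the coefficients are smooth, so that derivations can be applied to the expansion.\<close>

lemma Hadamard:
  fixes F :: "'e::euclidean_space \<Rightarrow> real"
  assumes "smooth_on (ball a r) F" "r > 0"
  obtains h where "\<And>i. smooth_on (ball a r) (h i)"
    "\<And>x. x \<in> ball a r \<Longrightarrow> F x = F a + (\<Sum>i\<in>Basis. (x \<bullet> i - a \<bullet> i) * h i x)"
    "\<And>i. h i a = frechet_derivative F (at a) i"
proof
  define D where "D x v = frechet_derivative F (at x) v" for x v
  have Ds: "smooth_on (ball a r) (\<lambda>x. D x v)" for v
    unfolding D_def by (rule smooth_on_frechet_derivative[OF assms(1)])
  let ?h = "\<lambda>i x. integral {0..1} (\<lambda>t. D (a + t *\<^sub>R (x - a)) i)"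
  show "smooth_on (ball a r) (?h i)" for i
    using smooth_on_ray_integral[OF Ds, of 0 i] by simp
  show "?h i a = frechet_derivative F (at a) i" for i by (simp add: D_def)
  fix x assume x: "x \<in> ball a r"
  note ray = ray_in_ball[OF x]
  have D: "(F has_derivative D y) (at y)" if "y \<in> ball a r" for y
    using smooth_on_has_derivative[OF assms(1) that] by (simp add: D_def[abs_def])
  have "((\<lambda>t. D (a + t *\<^sub>R (x - a)) (x - a)) has_integral
      F (a + 1 *\<^sub>R (x - a)) - F (a + 0 *\<^sub>R (x - a))) {0..1}"
  proof (rule fundamental_theorem_of_calculus)
    fix t :: real assume t: "t \<in> {0..1}"
    have "((\<lambda>t. F (a + t *\<^sub>R (x - a))) has_derivative (\<lambda>s. D (a + t *\<^sub>R (x - a)) (s *\<^sub>R (x - a)))) (at t within {0..1})"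
      by (rule has_derivative_compose[where f = "\<lambda>t. a + t *\<^sub>R (x - a)" and g = F, OF _ D[OF ray[OF t]]])
         (auto intro!: derivative_eq_intros)
    then show "((\<lambda>t. F (a + t *\<^sub>R (x - a))) has_vector_derivative D (a + t *\<^sub>R (x - a)) (x - a)) (at t within {0..1})"
      by (simp add: has_vector_derivative_def linear_cmul[OF has_derivative_linear[OF D[OF ray[OF t]]]])
  qed simp
  then have "F x - F a = integral {0..1} (\<lambda>t. D (a + t *\<^sub>R (x - a)) (x - a))"
    by (simp add: integral_unique)
  also have "\<dots> = integral {0..1} (\<lambda>t. \<Sum>i\<in>Basis. (x \<bullet> i - a \<bullet> i) * D (a + t *\<^sub>R (x - a)) i)"
  proof (rule integral_cong)
    fix t :: real assume t: "t \<in> {0..1}"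
    interpret linear "D (a + t *\<^sub>R (x - a))" using D[OF ray[OF t]] has_derivative_linear by blast
    have "D (a + t *\<^sub>R (x - a)) (x - a) = D (a + t *\<^sub>R (x - a)) (\<Sum>i\<in>Basis. ((x - a) \<bullet> i) *\<^sub>R i)"
      by (simp add: euclidean_representation)
    then show "D (a + t *\<^sub>R (x - a)) (x - a) = (\<Sum>i\<in>Basis. (x \<bullet> i - a \<bullet> i) * D (a + t *\<^sub>R (x - a)) i)"
      by (simp add: sum scale inner_diff_left)
  qed
  also have "\<dots> = (\<Sum>i\<in>Basis. (x \<bullet> i - a \<bullet> i) * ?h i x)"
    by (subst integral_sum)
       (auto intro!: integrable_continuous_real continuous_intros
          continuous_on_compose2[OF smooth_on_imp_continuous_on[OF Ds]] ray simp del: mem_ball)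
  finally show "F x = F a + (\<Sum>i\<in>Basis. (x \<bullet> i - a \<bullet> i) * ?h i x)" by simp
qed

section \<open>Smooth functions, tangent vectors and local frames on a manifold\<close>

locale manifold =
  fixes A :: "('a::{t2_space,second_countable_topology}, 'e::euclidean_space) chart set"
  assumes smooth_manifold: "smooth_manifold A"
begin

abbreviation "C\<^sub>M \<equiv> smooth_functions A"
abbreviation "VF \<equiv> vector_fields A"
abbreviation "T\<^sub>M \<equiv> tangent_space A"

lemma chart:
  assumes "(U, \<phi>) \<in> A"
  shows "open U" "open (\<phi> ` U)" "homeomorphism U (\<phi> ` U) \<phi> (inv_into U \<phi>)"
    "continuous_on U \<phi>" "continuous_on (\<phi> ` U) (inv_into U \<phi>)"
    "\<And>q. q \<in> U \<Longrightarrow> inv_into U \<phi> (\<phi> q) = q"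
    "\<And>y. y \<in> \<phi> ` U \<Longrightarrow> inv_into U \<phi> y \<in> U"
    "\<And>y. y \<in> \<phi> ` U \<Longrightarrow> \<phi> (inv_into U \<phi> y) = y"
proof -
  show *: "open U" "open (\<phi> ` U)" and h: "homeomorphism U (\<phi> ` U) \<phi> (inv_into U \<phi>)"
    using smooth_manifold assms unfolding smooth_manifold_def by auto
  show "continuous_on U \<phi>" "continuous_on (\<phi> ` U) (inv_into U \<phi>)"
    "\<And>q. q \<in> U \<Longrightarrow> inv_into U \<phi> (\<phi> q) = q"
    using h unfolding homeomorphism_def by auto
  show "\<And>y. y \<in> \<phi> ` U \<Longrightarrow> inv_into U \<phi> y \<in> U" by (rule inv_into_into)
  show "\<And>y. y \<in> \<phi> ` U \<Longrightarrow> \<phi> (inv_into U \<phi> y) = y" by (rule f_inv_into_f)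
qed

lemma transition_smooth:
  assumes "(U, \<phi>) \<in> A" "(V, \<psi>) \<in> A"
  shows "smooth_on (\<phi> ` (U \<inter> V)) (\<psi> \<circ> inv_into U \<phi>)"
  using smooth_manifold assms unfolding smooth_manifold_def by fast

lemma chart_at:
  obtains U \<phi> where "(U, \<phi>) \<in> A" "p \<in> U"
proof -
  have "p \<in> (\<Union>(U, \<phi>)\<in>A. U)" using smooth_manifold unfolding smooth_manifold_def by simp
  then show ?thesis using that by auto
qed

lemma C_I: "(\<And>U \<phi>. (U, \<phi>) \<in> A \<Longrightarrow> smooth_on (\<phi> ` U) (\<lambda>y. f (inv_into U \<phi> y))) \<Longrightarrow> f \<in> C\<^sub>M"
  unfolding smooth_functions_def o_def by auto

lemma C_D: "f \<in> C\<^sub>M \<Longrightarrow> (U, \<phi>) \<in> A \<Longrightarrow> smooth_on (\<phi> ` U) (\<lambda>y. f (inv_into U \<phi> y))"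
  unfolding smooth_functions_def o_def by auto

lemma C_const [simp]: "(\<lambda>p. c) \<in> C\<^sub>M"
  by (rule C_I) (simp add: smooth_on_const chart)

lemma C_add: "f \<in> C\<^sub>M \<Longrightarrow> h \<in> C\<^sub>M \<Longrightarrow> (\<lambda>p. f p + h p) \<in> C\<^sub>M"
  by (rule C_I) (simp add: smooth_on_add chart C_D)

lemma C_mult: "f \<in> C\<^sub>M \<Longrightarrow> h \<in> C\<^sub>M \<Longrightarrow> (\<lambda>p. f p * h p) \<in> C\<^sub>M"
  by (rule C_I) (simp add: smooth_on_mult chart C_D)

lemma C_diff: "f \<in> C\<^sub>M \<Longrightarrow> h \<in> C\<^sub>M \<Longrightarrow> (\<lambda>p. f p - h p) \<in> C\<^sub>M"
  by (rule C_I) (simp add: smooth_on_diff chart C_D)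

lemma C_uminus: "f \<in> C\<^sub>M \<Longrightarrow> (\<lambda>p. - f p) \<in> C\<^sub>M"
  using C_diff[OF C_const[of 0]] by simp

lemma C_sum: "(\<And>i. i \<in> I \<Longrightarrow> f i \<in> C\<^sub>M) \<Longrightarrow> (\<lambda>p. \<Sum>i\<in>I. f i p) \<in> C\<^sub>M"
  by (rule C_I) (simp add: smooth_on_sum chart C_D)

lemmas C_intros = C_const C_add C_mult C_diff C_uminus C_sum

text \<open>Smoothness is local, and local smoothness can be certified by global functions: near \<open>p\<close> the
  function \<open>f\<close> is a quotient of global smooth functions. It serves to glue
  local solutions, in place of a partition of unity.\<close>

lemma C_local_quotient:
  assumes "\<And>p. \<exists>\<rho>\<in>C\<^sub>M. \<rho> p \<noteq> 0 \<and> (\<lambda>q. \<rho> q * f q) \<in> C\<^sub>M"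
  shows "f \<in> C\<^sub>M"
proof (rule C_I, rule smooth_on_local)
  fix U \<phi> x
  assume U: "(U, \<phi>) \<in> A" and x: "x \<in> \<phi> ` U"
  let ?i = "inv_into U \<phi>"
  obtain \<rho> where \<rho>: "\<rho> \<in> C\<^sub>M" "\<rho> (?i x) \<noteq> 0" "(\<lambda>q. \<rho> q * f q) \<in> C\<^sub>M"
    using assms by blast
  let ?N = "\<phi> ` U \<inter> (\<lambda>y. \<rho> (?i y)) -` (- {0})"
  have N: "open ?N"
    by (rule continuous_open_preimage[OF smooth_on_imp_continuous_on[OF C_D[OF \<rho>(1) U]]])
       (use chart[OF U] in auto)
  have "smooth_on ?N (\<lambda>y. inverse (\<rho> (?i y)) * (\<rho> (?i y) * f (?i y)))"
    by (intro smooth_on_mult smooth_on_inverse N smooth_on_subset[OF C_D[OF \<rho>(1) U]]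
        smooth_on_subset[OF C_D[OF \<rho>(3) U]]) auto
  then have "smooth_on ?N (\<lambda>y. f (?i y))"
    by (rule smooth_on_cong[OF N, rotated]) auto
  then show "\<exists>N. open N \<and> x \<in> N \<and> smooth_on N (\<lambda>y. f (?i y))"
    using N x \<rho>(2) by (intro exI[of _ ?N]) auto
qed

definition chart_extend :: "'a set \<Rightarrow> ('a \<Rightarrow> 'e) \<Rightarrow> ('e \<Rightarrow> real) \<Rightarrow> 'a \<Rightarrow> real" where
  "chart_extend U \<phi> u = (\<lambda>q. if q \<in> U then u (\<phi> q) else 0)"

text \<open>The Hausdorff property enters here: the support, compact in the chart domain,
  is closed in the manifold, so the extension vanishes on a neighbourhood of every point outside
  the chart domain.\<close>

lemma C_chart_extend:
  assumes U: "(U, \<phi>) \<in> A" and K: "compact K" "K \<subseteq> W" and W: "open W" "W \<subseteq> \<phi> ` U"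
    and u: "smooth_on W u" "\<And>y. y \<in> \<phi> ` U - K \<Longrightarrow> u y = 0"
  shows "chart_extend U \<phi> u \<in> C\<^sub>M"
proof (rule C_I, rule smooth_on_local)
  fix V \<psi> x
  assume V: "(V, \<psi>) \<in> A" and x: "x \<in> \<psi> ` V"
  let ?i = "inv_into U \<phi>" and ?j = "inv_into V \<psi>"
  note jc = continuous_open_preimage[OF chart(5)[OF V] chart(2)[OF V]]
  have su: "smooth_on (\<phi> ` U) u"
  proof (rule smooth_on_local)
    fix y assume y: "y \<in> \<phi> ` U"
    have "open (\<phi> ` U - K)" using chart(2)[OF U] K(1) by (simp add: open_Diff compact_imp_closed)
    moreover have "smooth_on (\<phi> ` U - K) u"
      by (rule smooth_on_cong[OF calculation _ smooth_on_const[OF calculation, of 0]]) (simp add: u(2))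
    ultimately show "\<exists>N. open N \<and> y \<in> N \<and> smooth_on N u"
      using K W u(1) y by (cases "y \<in> K") blast+
  qed
  show "\<exists>N. open N \<and> x \<in> N \<and> smooth_on N (\<lambda>y. chart_extend U \<phi> u (?j y))"
  proof (cases "?j x \<in> U")
    case True
    let ?N = "\<psi> ` V \<inter> ?j -` U"
    have N: "open ?N" by (rule jc[OF chart(1)[OF U]])
    have "\<psi> ` (V \<inter> U) = ?N" using chart[OF V] by (auto simp: image_iff) 
    then have s: "smooth_on ?N (\<lambda>y. \<phi> (?j y))"
      using transition_smooth[OF V U] by (simp add: o_def)
    have "smooth_on ?N (\<lambda>y. u (\<phi> (?j y)))"
      by (rule smooth_on_compose[OF N chart(2)[OF U] _ s su]) auto
    then have "smooth_on ?N (\<lambda>y. chart_extend U \<phi> u (?j y))"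
      by (rule smooth_on_cong[OF N, rotated]) (simp add: chart_extend_def)
    then show ?thesis using N x True by (intro exI[of _ ?N]) auto
  next
    case False
    let ?L = "?i ` K" and ?N = "\<psi> ` V \<inter> ?j -` (- ?i ` K)"
    have KU: "K \<subseteq> \<phi> ` U" using K W by blast
    have "compact ?L"
      by (rule compact_continuous_image[OF continuous_on_subset[OF chart(5)[OF U] KU] K(1)])
    then have N: "open ?N" by (intro jc) (simp add: open_Compl compact_imp_closed)
    have "?L \<subseteq> U" using KU chart(7)[OF U] by blast
    have z: "chart_extend U \<phi> u (?j y) = 0" if "y \<in> ?N" for y
    proof (cases "?j y \<in> U")
      case True
      have "\<phi> (?j y) \<notin> K"
      proof
        assume "\<phi> (?j y) \<in> K"
        then have "?i (\<phi> (?j y)) \<in> ?L" by blast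
        then show False using that chart(6)[OF U True] by simp
      qed
      then show ?thesis using True u(2) by (simp add: chart_extend_def)
    qed (simp add: chart_extend_def)
    have "smooth_on ?N (\<lambda>y. chart_extend U \<phi> u (?j y))"
      by (rule smooth_on_cong[OF N _ smooth_on_const[OF N, of 0]]) (simp add: z)
    then show ?thesis using N x False \<open>?L \<subseteq> U\<close> by (intro exI[of _ ?N]) auto
  qed
qed

subsection \<open>Tangent vectors\<close>

lemma tangent_add: "v \<in> T\<^sub>M p \<Longrightarrow> f \<in> C\<^sub>M \<Longrightarrow> h \<in> C\<^sub>M \<Longrightarrow> v (\<lambda>q. f q + h q) = v f + v h"
  and tangent_scale: "v \<in> T\<^sub>M p \<Longrightarrow> f \<in> C\<^sub>M \<Longrightarrow> v (\<lambda>q. c * f q) = c * v f"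
  and tangent_mult: "v \<in> T\<^sub>M p \<Longrightarrow> f \<in> C\<^sub>M \<Longrightarrow> h \<in> C\<^sub>M \<Longrightarrow> v (\<lambda>q. f q * h q) = f p * v h + h p * v f"
  and tangent_not_smooth: "v \<in> T\<^sub>M p \<Longrightarrow> f \<notin> C\<^sub>M \<Longrightarrow> v f = 0"
  unfolding tangent_space_def by auto

lemma tangent_const: "v \<in> T\<^sub>M p \<Longrightarrow> v (\<lambda>q. c) = 0"
  using tangent_mult[of v p "\<lambda>q. 1" "\<lambda>q. 1"] tangent_scale[of v p "\<lambda>q. 1" c] by simp

lemma tangent_uminus: "v \<in> T\<^sub>M p \<Longrightarrow> f \<in> C\<^sub>M \<Longrightarrow> v (\<lambda>q. - f q) = - v f"
  using tangent_scale[of v p f "-1"] by simp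

lemma tangent_diff: "v \<in> T\<^sub>M p \<Longrightarrow> f \<in> C\<^sub>M \<Longrightarrow> h \<in> C\<^sub>M \<Longrightarrow> v (\<lambda>q. f q - h q) = v f - v h"
  using tangent_add[of v p f "\<lambda>q. - h q"] tangent_uminus[of v p h] by (simp add: C_uminus)

lemma tangent_sum:
  "v \<in> T\<^sub>M p \<Longrightarrow> (\<And>i. i \<in> I \<Longrightarrow> f i \<in> C\<^sub>M) \<Longrightarrow> v (\<lambda>q. \<Sum>i\<in>I. f i q) = (\<Sum>i\<in>I. v (f i))"
proof (induction I rule: infinite_finite_induct)
  case (insert i I)
  have "v (\<lambda>q. f i q + (\<Sum>i\<in>I. f i q)) = v (f i) + v (\<lambda>q. \<Sum>i\<in>I. f i q)"
    by (rule tangent_add[OF insert.prems(1)]) (auto intro!: C_sum insert.prems(2))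
  then show ?case using insert by simp
qed (simp_all add: tangent_const)

lemma tangent_mult_vanishing:
  "v \<in> T\<^sub>M p \<Longrightarrow> f \<in> C\<^sub>M \<Longrightarrow> h \<in> C\<^sub>M \<Longrightarrow> h p = 0 \<Longrightarrow> v (\<lambda>q. f q * h q) = f p * v h"
  by (simp add: tangent_mult)

text \<open>Derivations are determined by their values on coordinates: apply \<open>v\<close> to Hadamard's expansion
  of \<open>f\<close> around \<open>q\<close>, made global by cutting it off with a bump function \<open>c\<close>. Two factors \<open>c\<close> are
  used on the left-hand side, since both factors of each product on the right-hand side have to be
  extended to the manifold.\<close>

lemma tangent_in_coordinates:
  assumes U: "(U, \<phi>) \<in> A" "q \<in> U" and s: "s > 0" "ball (\<phi> q) s \<subseteq> \<phi> ` U"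
    and x: "\<And>i. x i \<in> C\<^sub>M" "\<And>i q'. q' \<in> U \<Longrightarrow> \<phi> q' \<in> ball (\<phi> q) s \<Longrightarrow> x i q' = \<phi> q' \<bullet> i"
    and v: "v \<in> T\<^sub>M q" and f: "f \<in> C\<^sub>M"
  shows "v f = (\<Sum>i\<in>Basis. v (x i) * frechet_derivative (\<lambda>y. f (inv_into U \<phi> y)) (at (\<phi> q)) i)"
proof -
  let ?y = "\<phi> q" and ?F = "\<lambda>y. f (inv_into U \<phi> y)"
  obtain h where h: "\<And>i. smooth_on (ball ?y s) (h i)"
    "\<And>z. z \<in> ball ?y s \<Longrightarrow> ?F z = ?F ?y + (\<Sum>i\<in>Basis. (z \<bullet> i - ?y \<bullet> i) * h i z)"
    "\<And>i. h i ?y = frechet_derivative ?F (at ?y) i"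
    using Hadamard[OF smooth_on_subset[OF C_D[OF f U(1)] s(2)] s(1)] by blast
  obtain c :: "'e \<Rightarrow> real" where c: "smooth_on UNIV c"
    "\<And>y. y \<in> cball ?y (s/3) \<Longrightarrow> c y = 1" "\<And>y. y \<notin> ball ?y (s/2) \<Longrightarrow> c y = 0"
    by (rule bump_function_exists[of "s/3" "s/2" ?y]) (use s in auto)
  have cy: "c ?y = 1" by (rule c(2)) (use s in simp)
  have cs: "smooth_on (ball ?y s) c" by (rule smooth_on_subset[OF c(1)]) simp
  have K: "compact (cball ?y (s/2))" "cball ?y (s/2) \<subseteq> ball ?y s"
    using s(1) by (auto simp: subset_eq)
  have cK: "c y = 0" if "y \<in> \<phi> ` U - cball ?y (s/2)" for y using c(3) that by auto
  let ?c = "chart_extend U \<phi> c" and ?h = "\<lambda>i. chart_extend U \<phi> (\<lambda>z. c z * h i z)"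
  have C: "?c \<in> C\<^sub>M" by (rule C_chart_extend[OF U(1) K open_ball s(2) cs cK])
  have H: "?h i \<in> C\<^sub>M" for i
    by (rule C_chart_extend[OF U(1) K open_ball s(2) smooth_on_mult[OF open_ball cs h(1)]]) (simp add: cK)
  have eq: "(\<lambda>q'. ?c q' * (?c q' * (f q' - f q))) =
      (\<lambda>q'. \<Sum>i\<in>Basis. ?h i q' * (?c q' * (x i q' - x i q)))"
  proof
    fix q'
    show "?c q' * (?c q' * (f q' - f q)) = (\<Sum>i\<in>Basis. ?h i q' * (?c q' * (x i q' - x i q)))"
    proof (cases "q' \<in> U \<and> c (\<phi> q') \<noteq> 0")
      case True
      then have "\<phi> q' \<in> ball ?y (s/2)" using c(3) by blast
      then have b: "\<phi> q' \<in> ball ?y s" using s(1) by auto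
      have "f q' - f q = (\<Sum>i\<in>Basis. (\<phi> q' \<bullet> i - ?y \<bullet> i) * h i (\<phi> q'))"
        using h(2)[OF b] True U by (simp add: chart(6))
      moreover have "x i q' = \<phi> q' \<bullet> i" "x i q = ?y \<bullet> i" for i
        using x(2)[OF _ b] x(2)[of q] True U s(1) by auto
      ultimately show ?thesis
        using True by (simp add: chart_extend_def sum_distrib_left mult_ac)
    qed (auto simp: chart_extend_def)
  qed
  have c1: "?c q = 1" and h1: "?h i q = frechet_derivative ?F (at ?y) i" for i
    using U cy h(3) by (simp_all add: chart_extend_def)
  note ci = C_intros C H f x(1)
  have vdiff: "v (\<lambda>q'. ?c q' * (k q' - k q)) = v k" if "k \<in> C\<^sub>M" for k
    using tangent_mult_vanishing[OF v C, of "\<lambda>q'. k q' - k q"] that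
    by (simp add: C_intros c1 tangent_diff[OF v] tangent_const[OF v])
  have "v (\<lambda>q'. ?c q' * (?c q' * (f q' - f q))) = v f"
    using tangent_mult_vanishing[OF v C, of "\<lambda>q'. ?c q' * (f q' - f q)"]
    by (simp add: ci c1 vdiff)
  moreover have "v (\<lambda>q'. \<Sum>i\<in>Basis. ?h i q' * (?c q' * (x i q' - x i q)))
      = (\<Sum>i\<in>Basis. v (\<lambda>q'. ?h i q' * (?c q' * (x i q' - x i q))))"
    by (rule tangent_sum[OF v]) (intro ci)
  moreover have "v (\<lambda>q'. ?h i q' * (?c q' * (x i q' - x i q)))
      = frechet_derivative ?F (at ?y) i * v (x i)" for i
    using tangent_mult_vanishing[OF v H, of "\<lambda>q'. ?c q' * (x i q' - x i q)" i]
    by (simp add: ci h1 vdiff)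
  ultimately show ?thesis unfolding eq by (simp add: mult.commute)
qed

subsection \<open>Vector fields\<close>

lemma VF_tangent: "X \<in> VF \<Longrightarrow> X p \<in> T\<^sub>M p"
  and VF_smooth: "X \<in> VF \<Longrightarrow> f \<in> C\<^sub>M \<Longrightarrow> (\<lambda>p. X p f) \<in> C\<^sub>M"
  unfolding vector_fields_def by auto

text \<open>A substitute for a frame near \<open>p\<close> made of global objects: cut-off coordinate functions \<open>x i\<close> and
  cut-off coordinate fields \<open>E i\<close>. The cut-off enters the expansion of tangent vectors as the weight
  \<open>w\<close>, which makes the expansion hold at every point of the manifold.\<close>

definition local_frame :: "'a \<Rightarrow> ('a \<Rightarrow> real) \<Rightarrow> ('e \<Rightarrow> 'a \<Rightarrow> real) \<Rightarrow> ('e \<Rightarrow> 'a vector_field) \<Rightarrow> bool" where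
  "local_frame p w x E \<longleftrightarrow> w \<in> C\<^sub>M \<and> w p = 1 \<and> (\<forall>i. x i \<in> C\<^sub>M) \<and> (\<forall>i. E i \<in> VF) \<and>
    (\<forall>i\<in>Basis. \<forall>j\<in>Basis. E i p (x j) = (if i = j then 1 else 0)) \<and>
    (\<forall>q. \<forall>v\<in>T\<^sub>M q. \<forall>f. w q * v f = (\<Sum>i\<in>Basis. v (x i) * E i q f))"

lemma local_frame_exists: "\<exists>w x E. local_frame p w x E"
proof -
  obtain U \<phi> where U: "(U, \<phi>) \<in> A" "p \<in> U" using chart_at by blast
  let ?a = "\<phi> p" and ?F = "\<lambda>f y. f (inv_into U \<phi> y)"
  obtain R where R: "R > 0" "cball ?a R \<subseteq> \<phi> ` U"
    using chart(2)[OF U(1)] U(2) open_contains_cball[of "\<phi> ` U"] by blast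
  \<comment> \<open>Two bump functions: \<open>b1\<close> is \<open>1\<close> on the support of \<open>b2\<close>, so that wherever the fields cut off by
    \<open>b2\<close> do not vanish, the functions cut off by \<open>b1\<close> are genuine coordinates.\<close>
  obtain b1 :: "'e \<Rightarrow> real" where b1: "smooth_on UNIV b1"
    "\<And>y. y \<in> cball ?a (R/2) \<Longrightarrow> b1 y = 1" "\<And>y. y \<notin> ball ?a R \<Longrightarrow> b1 y = 0"
    by (rule bump_function_exists[of "R/2" R ?a]) (use R in auto)
  obtain b2 :: "'e \<Rightarrow> real" where b2: "smooth_on UNIV b2"
    "\<And>y. y \<in> cball ?a (R/4) \<Longrightarrow> b2 y = 1" "\<And>y. y \<notin> ball ?a (R/2) \<Longrightarrow> b2 y = 0"
    by (rule bump_function_exists[of "R/4" "R/2" ?a]) (use R in auto)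
  have ext: "chart_extend U \<phi> (\<lambda>z. b z * k z) \<in> C\<^sub>M"
    if "smooth_on UNIV b" "\<And>y. y \<notin> ball ?a R \<Longrightarrow> b y = 0" "smooth_on (\<phi> ` U) k" for b k
    by (rule C_chart_extend[OF U(1) compact_cball R(2) chart(2)[OF U(1)] order.refl])
       (use that chart(2)[OF U(1)] in \<open>auto intro!: smooth_on_mult smooth_on_subset[OF that(1)]\<close>)
  have b2': "b2 y = 0" if "y \<notin> ball ?a R" for y using b2(3) that R by auto
  define w where "w = chart_extend U \<phi> b2"
  define x where "x i = chart_extend U \<phi> (\<lambda>z. b1 z * (z \<bullet> i))" for i
  define E where "E i q f = (if f \<in> C\<^sub>M \<and> q \<in> U
      then b2 (\<phi> q) * frechet_derivative (?F f) (at (\<phi> q)) i else 0)" for i q f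
  have d: "(?F f has_derivative frechet_derivative (?F f) (at (\<phi> q))) (at (\<phi> q))"
    if "f \<in> C\<^sub>M" "q \<in> U" for f q
    by (rule smooth_on_has_derivative[OF C_D[OF that(1) U(1)]]) (use that in auto)
  have Cw: "w \<in> C\<^sub>M" 
    using ext[OF b2(1) b2' smooth_on_const[OF chart(2)[OF U(1)], of 1]] by (simp add: w_def)
  moreover have "w p = 1" using b2(2) R U by (simp add: w_def chart_extend_def)
  moreover have Cx: "x i \<in> C\<^sub>M" for i
    unfolding x_def by (rule ext[OF b1(1,3) smooth_on_inner[OF chart(2)[OF U(1)]]])
  moreover have "E i \<in> VF" for i
    unfolding vector_fields_def
  proof (intro CollectI conjI allI ballI)
    fix q
    show "E i q \<in> T\<^sub>M q"
      unfolding tangent_space_def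
    proof (intro CollectI conjI allI ballI impI)
      fix f h assume fh: "f \<in> C\<^sub>M" "h \<in> C\<^sub>M"
      show "E i q (\<lambda>q. f q + h q) = E i q f + E i q h"
      proof (cases "q \<in> U")
        case True
        show ?thesis
          using True fh C_add[OF fh]
            fun_cong[OF sym[OF frechet_derivative_at[OF has_derivative_add[OF d[OF fh(1) True] d[OF fh(2) True]]]], of i]
          by (simp add: E_def distrib_left)
      qed (simp add: E_def)
      show "E i q (\<lambda>q. f q * h q) = f q * E i q h + h q * E i q f"
      proof (cases "q \<in> U")
        case True
        show ?thesis
          using True fh C_mult[OF fh] chart(6)[OF U(1) True]
            fun_cong[OF sym[OF frechet_derivative_at[OF has_derivative_mult[OF d[OF fh(1) True] d[OF fh(2) True]]]], of i]
          by (simp add: E_def algebra_simps)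
      qed (simp add: E_def)
    next
      fix c f assume f: "f \<in> C\<^sub>M"
      show "E i q (\<lambda>q. c * f q) = c * E i q f"
      proof (cases "q \<in> U")
        case True
        show ?thesis
          using True f C_mult[OF C_const[of c] f]
            fun_cong[OF sym[OF frechet_derivative_at[OF has_derivative_mult_right[OF d[OF f True], of c]]], of i]
          by (simp add: E_def)
      qed (simp add: E_def)
    next
      fix f assume "f \<notin> C\<^sub>M"
      then show "E i q f = 0" by (simp add: E_def)
    qed
  next
    fix f assume f: "f \<in> C\<^sub>M"
    have "(\<lambda>q. E i q f) = chart_extend U \<phi> (\<lambda>z. b2 z * frechet_derivative (?F f) (at z) i)"
      using f by (auto simp: E_def chart_extend_def)
    then show "(\<lambda>q. E i q f) \<in> C\<^sub>M"
      using ext[OF b2(1) b2' smooth_on_frechet_derivative[OF C_D[OF f U(1)]]] by simp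
  qed
  moreover have "E i p (x j) = (if i = j then 1 else 0)" if "i \<in> Basis" "j \<in> Basis" for i j
  proof -
    have "(?F (x j) has_derivative (\<lambda>v. v \<bullet> j)) (at ?a)"
    proof (rule has_derivative_transform_within_open[where s = "ball ?a (R/2)" and f = "\<lambda>z. z \<bullet> j"])
      show "((\<lambda>z. z \<bullet> j) has_derivative (\<lambda>v. v \<bullet> j)) (at ?a)"
        by (auto intro!: derivative_eq_intros)
      fix z assume z: "z \<in> ball ?a (R/2)"
      then have "z \<in> \<phi> ` U" using R by auto
      then show "z \<bullet> j = ?F (x j) z"
        using z b1(2)[of z] chart(7,8)[OF U(1), of z] by (simp add: x_def chart_extend_def)
    qed (use R in auto)
    then have "frechet_derivative (?F (x j)) (at ?a) i = i \<bullet> j"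
      using frechet_derivative_at by metis
    then show ?thesis using that U R b2(2)[of ?a] Cx by (simp add: E_def inner_Basis)
  qed
  moreover have "w q * v f = (\<Sum>i\<in>Basis. v (x i) * E i q f)" if v: "v \<in> T\<^sub>M q" for q v f
  proof (cases "f \<in> C\<^sub>M \<and> q \<in> U \<and> \<phi> q \<in> ball ?a (R/2)")
    case True
    then obtain s where s: "s > 0" "ball (\<phi> q) s \<subseteq> ball ?a (R/2)"
      using open_contains_ball[of "ball ?a (R/2)"] by blast
    have "ball ?a (R/2) \<subseteq> \<phi> ` U" using R by auto
    then have sU: "ball (\<phi> q) s \<subseteq> \<phi> ` U" by (rule subset_trans[OF s(2)])
    have xq: "x i q' = \<phi> q' \<bullet> i" if "q' \<in> U" "\<phi> q' \<in> ball (\<phi> q) s" for i q'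
    proof -
      have "\<phi> q' \<in> ball ?a (R/2)" using s(2) that(2) by blast
      then show ?thesis using that(1) b1(2)[of "\<phi> q'"] by (simp add: x_def chart_extend_def)
    qed
    have "v f = (\<Sum>i\<in>Basis. v (x i) * frechet_derivative (?F f) (at (\<phi> q)) i)"
      by (rule tangent_in_coordinates[OF U(1) _ s(1) sU Cx xq v]) (use True in auto)
    then show ?thesis
      using True by (simp add: w_def E_def chart_extend_def sum_distrib_left mult_ac)
  next
    case False
    then show ?thesis
      using tangent_not_smooth[OF v] b2(3)[of "\<phi> q"] by (auto simp: w_def E_def chart_extend_def intro!: sum.neutral)
  qed
  ultimately have "local_frame p w x E" unfolding local_frame_def by simp
  then show ?thesis by blast
qed

abbreviation "\<Omega> \<equiv> one_forms A"

lemma tangent_I: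
  assumes "\<And>f h. f \<in> C\<^sub>M \<Longrightarrow> h \<in> C\<^sub>M \<Longrightarrow> v (\<lambda>q. f q + h q) = v f + v h"
    and "\<And>c f. f \<in> C\<^sub>M \<Longrightarrow> v (\<lambda>q. c * f q) = c * v f"
    and "\<And>f h. f \<in> C\<^sub>M \<Longrightarrow> h \<in> C\<^sub>M \<Longrightarrow> v (\<lambda>q. f q * h q) = f p * v h + h p * v f"
    and "\<And>f. f \<notin> C\<^sub>M \<Longrightarrow> v f = 0"
  shows "v \<in> T\<^sub>M p"
  using assms unfolding tangent_space_def by blast

lemma VF_I: "(\<And>p. X p \<in> T\<^sub>M p) \<Longrightarrow> (\<And>f. f \<in> C\<^sub>M \<Longrightarrow> (\<lambda>p. X p f) \<in> C\<^sub>M) \<Longrightarrow> X \<in> VF"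
  unfolding vector_fields_def by blast

lemmas VF_tangent_simps =
  tangent_add[OF VF_tangent] tangent_scale[OF VF_tangent] tangent_mult[OF VF_tangent]
  tangent_not_smooth[OF VF_tangent] tangent_const[OF VF_tangent] tangent_diff[OF VF_tangent]
  tangent_uminus[OF VF_tangent]

lemma VF_apply: "X \<in> VF \<Longrightarrow> f \<in> C\<^sub>M \<Longrightarrow> vf_apply X f \<in> C\<^sub>M"
  unfolding vf_apply_def by (rule VF_smooth)

lemma VF_add: "X \<in> VF \<Longrightarrow> Y \<in> VF \<Longrightarrow> vf_add X Y \<in> VF"
  by (rule VF_I, rule tangent_I) (simp_all add: vf_add_def VF_tangent_simps C_add VF_smooth algebra_simps)

lemma VF_diff: "X \<in> VF \<Longrightarrow> Y \<in> VF \<Longrightarrow> vf_diff X Y \<in> VF"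
  by (rule VF_I, rule tangent_I) (simp_all add: vf_diff_def VF_tangent_simps C_diff VF_smooth algebra_simps)

lemma VF_scale: "\<phi> \<in> C\<^sub>M \<Longrightarrow> X \<in> VF \<Longrightarrow> vf_scale \<phi> X \<in> VF"
  by (rule VF_I, rule tangent_I) (simp_all add: vf_scale_def VF_tangent_simps C_mult VF_smooth algebra_simps)

lemma VF_zero: "(\<lambda>p f. 0) \<in> VF"
  by (rule VF_I, rule tangent_I) simp_all

lemma VF_lie_bracket:
  assumes X: "X \<in> VF" and Y: "Y \<in> VF"
  shows "lie_bracket X Y \<in> VF"
proof (rule VF_I, rule tangent_I)
  note s = VF_tangent_simps[OF X] VF_tangent_simps[OF Y] VF_smooth[OF X] VF_smooth[OF Y] C_add C_mult
  fix p c f h assume f: "f \<in> C\<^sub>M" and h: "h \<in> C\<^sub>M"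
  show "lie_bracket X Y p (\<lambda>q. f q + h q) = lie_bracket X Y p f + lie_bracket X Y p h"
    using f h by (simp add: lie_bracket_def vf_apply_def s)
  show "lie_bracket X Y p (\<lambda>q. c * f q) = c * lie_bracket X Y p f"
    using f by (simp add: lie_bracket_def vf_apply_def s algebra_simps)
  show "lie_bracket X Y p (\<lambda>q. f q * h q) = f p * lie_bracket X Y p h + h p * lie_bracket X Y p f"
    using f h by (simp add: lie_bracket_def vf_apply_def s algebra_simps)
next
  fix p f assume "f \<notin> C\<^sub>M"
  then show "lie_bracket X Y p f = 0"
    by (simp add: lie_bracket_def vf_apply_def VF_tangent_simps X Y)
next
  fix f assume "f \<in> C\<^sub>M"
  then show "(\<lambda>p. lie_bracket X Y p f) \<in> C\<^sub>M"
    by (simp add: lie_bracket_def vf_apply_def C_diff VF_smooth X Y)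
qed

definition vf_lincomb :: "'i set \<Rightarrow> ('i \<Rightarrow> 'a \<Rightarrow> real) \<Rightarrow> ('i \<Rightarrow> 'a vector_field) \<Rightarrow> 'a vector_field" where
  "vf_lincomb I \<phi> X = (\<lambda>p f. \<Sum>i\<in>I. \<phi> i p * X i p f)"

lemma vf_lincomb_empty: "vf_lincomb {} \<phi> X = (\<lambda>p f. 0)"
  by (simp add: vf_lincomb_def)

lemma vf_lincomb_insert:
  "finite I \<Longrightarrow> i \<notin> I \<Longrightarrow> vf_lincomb (insert i I) \<phi> X = vf_add (vf_scale (\<phi> i) (X i)) (vf_lincomb I \<phi> X)"
  by (simp add: vf_lincomb_def vf_add_def vf_scale_def)

lemma VF_lincomb:
  assumes "finite I" "\<And>i. i \<in> I \<Longrightarrow> \<phi> i \<in> C\<^sub>M" "\<And>i. i \<in> I \<Longrightarrow> X i \<in> VF"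
  shows "vf_lincomb I \<phi> X \<in> VF"
  using assms
  by (induction I) (simp_all add: vf_lincomb_empty vf_lincomb_insert VF_zero VF_add VF_scale)

subsection \<open>One-forms are pointwise\<close>

lemma form_smooth: "\<alpha> \<in> \<Omega> \<Longrightarrow> X \<in> VF \<Longrightarrow> \<alpha> X \<in> C\<^sub>M"
  and form_vf_add: "\<alpha> \<in> \<Omega> \<Longrightarrow> X \<in> VF \<Longrightarrow> Y \<in> VF \<Longrightarrow> \<alpha> (vf_add X Y) = (\<lambda>p. \<alpha> X p + \<alpha> Y p)"
  and form_vf_scale: "\<alpha> \<in> \<Omega> \<Longrightarrow> \<phi> \<in> C\<^sub>M \<Longrightarrow> X \<in> VF \<Longrightarrow> \<alpha> (vf_scale \<phi> X) = (\<lambda>p. \<phi> p * \<alpha> X p)"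
  and form_outside: "\<alpha> \<in> \<Omega> \<Longrightarrow> X \<notin> VF \<Longrightarrow> \<alpha> X = (\<lambda>p. 0)"
  unfolding one_forms_def by blast+

lemma form_eqI:
  assumes "\<alpha> \<in> \<Omega>" "\<beta> \<in> \<Omega>" "\<And>X p. X \<in> VF \<Longrightarrow> \<alpha> X p = \<beta> X p"
  shows "\<alpha> = \<beta>"
proof
  fix X show "\<alpha> X = \<beta> X"
    using assms(3) form_outside[OF assms(1)] form_outside[OF assms(2)] by (cases "X \<in> VF") auto
qed

lemma vf_diff_eq: "vf_diff X Y = vf_add X (vf_scale (\<lambda>p. -1) Y)"
  by (simp add: vf_diff_def vf_add_def vf_scale_def)

lemma form_vf_diff:
  "\<alpha> \<in> \<Omega> \<Longrightarrow> X \<in> VF \<Longrightarrow> Y \<in> VF \<Longrightarrow> \<alpha> (vf_diff X Y) = (\<lambda>p. \<alpha> X p - \<alpha> Y p)"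
  by (simp add: vf_diff_eq form_vf_add form_vf_scale VF_scale)

lemma form_vf_zero: "\<alpha> \<in> \<Omega> \<Longrightarrow> \<alpha> (\<lambda>p f. 0) = (\<lambda>p. 0)"
  using form_vf_scale[of \<alpha> "\<lambda>p. 0" "\<lambda>p f. 0"] by (simp add: vf_scale_def VF_zero)

lemma form_vf_lincomb:
  assumes "\<alpha> \<in> \<Omega>" "finite I" "\<And>i. i \<in> I \<Longrightarrow> \<phi> i \<in> C\<^sub>M" "\<And>i. i \<in> I \<Longrightarrow> X i \<in> VF"
  shows "\<alpha> (vf_lincomb I \<phi> X) = (\<lambda>p. \<Sum>i\<in>I. \<phi> i p * \<alpha> (X i) p)"
  using assms(2-4)
  by (induction I)
     (simp_all add: vf_lincomb_empty vf_lincomb_insert form_vf_zero form_vf_add form_vf_scale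
       VF_lincomb VF_scale assms(1))

lemma frame_smooth: "local_frame p w x E \<Longrightarrow> w \<in> C\<^sub>M" "local_frame p w x E \<Longrightarrow> x i \<in> C\<^sub>M"
  and frame_weight: "local_frame p w x E \<Longrightarrow> w p = 1"
  and frame_VF: "local_frame p w x E \<Longrightarrow> E i \<in> VF"
  and frame_dual: "local_frame p w x E \<Longrightarrow> i \<in> Basis \<Longrightarrow> j \<in> Basis \<Longrightarrow> E i p (x j) = (if i = j then 1 else 0)"
  and frame_expand: "local_frame p w x E \<Longrightarrow> v \<in> T\<^sub>M q \<Longrightarrow> w q * v f = (\<Sum>i\<in>Basis. v (x i) * E i q f)"
  unfolding local_frame_def by simp_all

lemma frame_expand_form:
  assumes F: "local_frame p w x E" and \<alpha>: "\<alpha> \<in> \<Omega>" and Y: "Y \<in> VF"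
  shows "w q * \<alpha> Y q = (\<Sum>i\<in>Basis. Y q (x i) * \<alpha> (E i) q)"
proof -
  have e: "vf_scale w Y = vf_lincomb Basis (\<lambda>i. vf_apply Y (x i)) E"
    by (simp add: vf_scale_def vf_lincomb_def vf_apply_def frame_expand[OF F VF_tangent[OF Y]])
  have "w q * \<alpha> Y q = \<alpha> (vf_scale w Y) q" by (simp add: form_vf_scale \<alpha> Y frame_smooth[OF F])
  also have "\<dots> = (\<Sum>i\<in>Basis. vf_apply Y (x i) q * \<alpha> (E i) q)"
    unfolding e by (subst form_vf_lincomb[OF \<alpha>]) (auto intro: VF_apply Y frame_smooth[OF F] frame_VF[OF F])
  finally show ?thesis by (simp add: vf_apply_def)
qed

text \<open>A map that is linear over the smooth functions is a pointwise object: expand both fields in a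
  local frame at \<open>p\<close>.\<close>

lemma form_pointwise:
  assumes "\<alpha> \<in> \<Omega>" "X \<in> VF" "Y \<in> VF" "X p = Y p"
  shows "\<alpha> X p = \<alpha> Y p"
proof -
  obtain w x E where F: "local_frame p w x E" using local_frame_exists by blast
  show ?thesis
    using frame_expand_form[OF F assms(1,2), of p] frame_expand_form[OF F assms(1,3), of p]
      frame_weight[OF F] assms(4) by simp
qed

subsection \<open>Linear systems over the smooth functions\<close>

text \<open>Gaussian elimination without division, over the ring of smooth functions: a system that is
  nonsingular at \<open>p\<close> has a solution up to a factor \<open>\<rho>\<close> that does not vanish at \<open>p\<close>. Because nothing is
  divided, the solution consists of global smooth functions. Rows and columns have different index
  sets, since the induction removes the row \<open>k\<close> and the column \<open>l\<close> of a pivot.\<close>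

lemma smooth_linear_system:
  fixes G :: "'i \<Rightarrow> 'j \<Rightarrow> 'a \<Rightarrow> real"
  assumes "finite I" "finite J" "card I = card J"
    and "\<And>i j. i \<in> I \<Longrightarrow> j \<in> J \<Longrightarrow> G i j \<in> C\<^sub>M" "\<And>j. j \<in> J \<Longrightarrow> b j \<in> C\<^sub>M"
    and "\<And>c i. (\<And>j. j \<in> J \<Longrightarrow> (\<Sum>i\<in>I. c i * G i j p) = 0) \<Longrightarrow> i \<in> I \<Longrightarrow> c i = 0"
  shows "\<exists>\<rho> x. \<rho> \<in> C\<^sub>M \<and> \<rho> p \<noteq> 0 \<and> (\<forall>i\<in>I. x i \<in> C\<^sub>M) \<and>
    (\<forall>j\<in>J. \<forall>q. (\<Sum>i\<in>I. x i q * G i j q) = \<rho> q * b j q)"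
  using assms
proof (induction I arbitrary: J G b rule: finite_induct)
  case empty
  then show ?case by (intro exI[of _ "\<lambda>q. 1"]) auto
next
  case (insert k I)
  note [simp] = insert.hyps
  have "\<exists>j\<in>J. G k j p \<noteq> 0"
  proof (rule ccontr)
    assume *: "\<not> ?thesis"
    have "(\<Sum>i\<in>insert k I. of_bool (i = k) * G i j p) = 0" if "j \<in> J" for j
    proof -
      have "(\<Sum>i\<in>I. of_bool (i = k) * G i j p) = 0" using insert.hyps(2) by (intro sum.neutral) auto
      then show ?thesis using * that by simp
    qed
    then show False using insert.prems(5)[of "\<lambda>i. of_bool (i = k)" k] by simp
  qed
  then obtain l where l: "l \<in> J" "G k l p \<noteq> 0" by blast
  let ?g = "G k l"
  define G' where "G' i j q = ?g q * G i j q - G i l q * G k j q" for i j q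
  define b' where "b' j q = ?g q * b j q - b l q * G k j q" for j q
  have G'_sum: "(\<Sum>i\<in>I. c i * G' i j q) =
      ?g q * (\<Sum>i\<in>I. c i * G i j q) - G k j q * (\<Sum>i\<in>I. c i * G i l q)" for c j q
    by (simp add: G'_def sum_distrib_left sum_subtractf algebra_simps)
  have G: "G i j \<in> C\<^sub>M" if "i = k \<or> i \<in> I" "j \<in> J" for i j using insert.prems(3) that by simp
  have b: "b j \<in> C\<^sub>M" if "j \<in> J" for j using insert.prems(4) that by simp
  have "\<exists>\<rho> x. \<rho> \<in> C\<^sub>M \<and> \<rho> p \<noteq> 0 \<and> (\<forall>i\<in>I. x i \<in> C\<^sub>M) \<and>
    (\<forall>j\<in>J - {l}. \<forall>q. (\<Sum>i\<in>I. x i q * G' i j q) = \<rho> q * b' j q)"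
  proof (rule insert.IH)
    show "finite (J - {l})" using insert.prems by simp
    show "card I = card (J - {l})" using insert.prems(1,2) l(1) by simp
    show "G' i j \<in> C\<^sub>M" if "i \<in> I" "j \<in> J - {l}" for i j
      unfolding G'_def[abs_def] using that l by (intro C_intros G) auto
    show "b' j \<in> C\<^sub>M" if "j \<in> J - {l}" for j
      unfolding b'_def[abs_def] using that l by (intro C_intros G b) auto
    fix c i assume c: "\<And>j. j \<in> J - {l} \<Longrightarrow> (\<Sum>i\<in>I. c i * G' i j p) = 0" and i: "i \<in> I"
    let ?c = "\<lambda>i. if i = k then - (\<Sum>i\<in>I. c i * G i l p) else c i * ?g p"
    have s: "(\<Sum>i\<in>I. ?c i * G i j p) = ?g p * (\<Sum>i\<in>I. c i * G i j p)" for j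
      unfolding sum_distrib_left using insert.hyps(2) by (intro sum.cong) auto
    have "(\<Sum>i\<in>insert k I. ?c i * G i j p) = 0" if j: "j \<in> J" for j
    proof -
      have "(\<Sum>i\<in>insert k I. ?c i * G i j p) =
          ?g p * (\<Sum>i\<in>I. c i * G i j p) - G k j p * (\<Sum>i\<in>I. c i * G i l p)"
        unfolding sum.insert[OF insert.hyps] s by simp
      then show ?thesis using c[of j] j G'_sum[of c j p] by (cases "j = l") auto
    qed
    then have "?c i = 0" using insert.prems(5)[of ?c i] i by simp
    then show "c i = 0" using i insert.hyps(2) l(2) by (auto split: if_splits)
  qed
  then obtain \<rho> x where \<rho>: "\<rho> \<in> C\<^sub>M" "\<rho> p \<noteq> 0" and x: "\<And>i. i \<in> I \<Longrightarrow> x i \<in> C\<^sub>M"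
    and e: "\<And>j q. j \<in> J - {l} \<Longrightarrow> (\<Sum>i\<in>I. x i q * G' i j q) = \<rho> q * b' j q" by blast
  define y where "y i q = (if i = k then \<rho> q * b l q - (\<Sum>i\<in>I. x i q * G i l q) else ?g q * x i q)" for i q
  have y: "y i \<in> C\<^sub>M" if "i \<in> insert k I" for i
  proof (cases "i = k")
    case True
    have "(\<lambda>q. \<rho> q * b l q - (\<Sum>i\<in>I. x i q * G i l q)) \<in> C\<^sub>M"
      by (intro C_intros \<rho> b l x G) auto
    then show ?thesis using True by (simp add: y_def[abs_def])
  next
    case False
    have "(\<lambda>q. ?g q * x i q) \<in> C\<^sub>M"
      by (intro C_intros x G l) (use that False in auto)
    then show ?thesis using False by (simp add: y_def[abs_def])
  qed
  have s: "(\<Sum>i\<in>I. y i q * G i j q) = ?g q * (\<Sum>i\<in>I. x i q * G i j q)" for j q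
    unfolding sum_distrib_left using insert.hyps(2) by (intro sum.cong) (auto simp: y_def)
  have "(\<Sum>i\<in>insert k I. y i q * G i j q) = (?g q * \<rho> q) * b j q" if j: "j \<in> J" for j q
  proof -
    have "(\<Sum>i\<in>insert k I. y i q * G i j q) =
        \<rho> q * b l q * G k j q + (\<Sum>i\<in>I. x i q * G' i j q)"
      unfolding sum.insert[OF insert.hyps] s G'_sum by (simp add: y_def algebra_simps)
    also have "\<dots> = (?g q * \<rho> q) * b j q"
    proof (cases "j = l")
      case True
      then show ?thesis by (simp add: G'_def)
    next
      case False
      then show ?thesis using e[of j q] j by (simp add: b'_def algebra_simps)
    qed
    finally show ?thesis .
  qed
  moreover have "(\<lambda>q. ?g q * \<rho> q) \<in> C\<^sub>M" by (intro C_intros \<rho> G l) auto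
  ultimately show ?case using y l \<rho>(2)
    by (intro exI[of _ "\<lambda>q. ?g q * \<rho> q"] exI[of _ y]) auto
qed

end

section \<open>The musical isomorphism of a pseudo-Riemannian metric\<close>

locale pseudo_riemannian_manifold = manifold A
  for A :: "('a::{t2_space,second_countable_topology}, 'e::euclidean_space) chart set" +
  fixes g :: "'a two_tensor"
  assumes metric: "pseudo_riemannian_metric A g"
begin

lemma flat_g_in: "X \<in> VF \<Longrightarrow> flat_g A g X \<in> \<Omega>"
  using metric unfolding pseudo_riemannian_metric_def flat_g_def by simp

lemma flat_g_apply: "Y \<in> VF \<Longrightarrow> flat_g A g X Y = g X Y"
  by (simp add: flat_g_def restrict_vf_def)

lemma g_sym: "X \<in> VF \<Longrightarrow> Y \<in> VF \<Longrightarrow> g X Y = g Y X"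
  using metric unfolding pseudo_riemannian_metric_def by blast

lemma g_nondegenerate: "X \<in> VF \<Longrightarrow> (\<And>Y. Y \<in> VF \<Longrightarrow> g X Y p = 0) \<Longrightarrow> X p = (\<lambda>f. 0)"
  using metric unfolding pseudo_riemannian_metric_def by blast

lemma g_smooth: "X \<in> VF \<Longrightarrow> Y \<in> VF \<Longrightarrow> g X Y \<in> C\<^sub>M"
  using form_smooth[OF flat_g_in] flat_g_apply by metis

lemma g_add_right: "X \<in> VF \<Longrightarrow> Y \<in> VF \<Longrightarrow> Z \<in> VF \<Longrightarrow> g X (vf_add Y Z) = (\<lambda>p. g X Y p + g X Z p)"
  using form_vf_add[OF flat_g_in, of X Y Z] by (simp add: flat_g_apply VF_add)

lemma g_diff_right: "X \<in> VF \<Longrightarrow> Y \<in> VF \<Longrightarrow> Z \<in> VF \<Longrightarrow> g X (vf_diff Y Z) = (\<lambda>p. g X Y p - g X Z p)"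
  using form_vf_diff[OF flat_g_in, of X Y Z] by (simp add: flat_g_apply VF_diff)

lemma g_scale_right: "X \<in> VF \<Longrightarrow> Y \<in> VF \<Longrightarrow> \<phi> \<in> C\<^sub>M \<Longrightarrow> g X (vf_scale \<phi> Y) = (\<lambda>p. \<phi> p * g X Y p)"
  using form_vf_scale[OF flat_g_in, of X \<phi> Y] by (simp add: flat_g_apply VF_scale)

lemma g_add_left: "X \<in> VF \<Longrightarrow> Y \<in> VF \<Longrightarrow> Z \<in> VF \<Longrightarrow> g (vf_add X Y) Z = (\<lambda>p. g X Z p + g Y Z p)"
  using g_add_right[of Z X Y] g_sym[of Z] by (simp add: VF_add)

lemma g_diff_left: "X \<in> VF \<Longrightarrow> Y \<in> VF \<Longrightarrow> Z \<in> VF \<Longrightarrow> g (vf_diff X Y) Z = (\<lambda>p. g X Z p - g Y Z p)"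
  using g_diff_right[of Z X Y] g_sym[of Z] by (simp add: VF_diff)

lemma g_scale_left: "X \<in> VF \<Longrightarrow> Y \<in> VF \<Longrightarrow> \<phi> \<in> C\<^sub>M \<Longrightarrow> g (vf_scale \<phi> X) Y = (\<lambda>p. \<phi> p * g X Y p)"
  using g_scale_right[of Y X \<phi>] g_sym[of Y] by (simp add: VF_scale)

lemma g_eqI_at:
  assumes "X \<in> VF" "Y \<in> VF" "\<And>Z. Z \<in> VF \<Longrightarrow> g X Z p = g Y Z p"
  shows "X p = Y p"
  using g_nondegenerate[of "vf_diff X Y" p] assms
  by (simp add: VF_diff g_diff_left) (simp add: vf_diff_def fun_eq_iff)

lemma g_eqI: "X \<in> VF \<Longrightarrow> Y \<in> VF \<Longrightarrow> (\<And>Z p. Z \<in> VF \<Longrightarrow> g X Z p = g Y Z p) \<Longrightarrow> X = Y"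
  using g_eqI_at by blast

lemma g_pointwise: "X \<in> VF \<Longrightarrow> Y \<in> VF \<Longrightarrow> Z \<in> VF \<Longrightarrow> X p = Y p \<Longrightarrow> g X Z p = g Y Z p"
  using form_pointwise[OF flat_g_in, of Z X Y p] by (simp add: flat_g_apply g_sym)

text \<open>Solve the linear system for the coefficients of the representing field in a local frame. By the
  nondegeneracy of the metric its matrix is nonsingular at \<open>p\<close>.\<close>

lemma local_representative:
  assumes \<alpha>: "\<alpha> \<in> \<Omega>"
  shows "\<exists>W \<rho>. W \<in> VF \<and> \<rho> \<in> C\<^sub>M \<and> \<rho> p \<noteq> 0 \<and> (\<forall>Y\<in>VF. \<forall>q. g W Y q = \<rho> q * \<alpha> Y q)"
proof -
  obtain w x E where L: "local_frame p w x E" using local_frame_exists by blast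
  note f = frame_smooth(1)[OF L] frame_weight[OF L] frame_smooth(2)[OF L] frame_VF[OF L] frame_dual[OF L]
  note F = frame_expand_form[OF L]
  have F_g: "w q * g X Y q = (\<Sum>i\<in>Basis. Y q (x i) * g X (E i) q)" if "X \<in> VF" "Y \<in> VF" for X Y q
    using F[OF flat_g_in[OF that(1)] that(2)] by (simp add: flat_g_apply f that)
  have g_lincomb: "g (vf_lincomb Basis c E) Y q = (\<Sum>i\<in>Basis. c i q * g (E i) Y q)"
    if "\<And>i. i \<in> Basis \<Longrightarrow> c i \<in> C\<^sub>M" "Y \<in> VF" for c :: "'e \<Rightarrow> 'a \<Rightarrow> real" and Y q
    using form_vf_lincomb[OF flat_g_in[OF that(2)] finite_Basis, of c E] that(1)
    by (simp add: flat_g_apply f g_sym[OF that(2)] VF_lincomb)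
  have "\<exists>\<rho> y. \<rho> \<in> C\<^sub>M \<and> \<rho> p \<noteq> 0 \<and> (\<forall>i\<in>Basis. y i \<in> C\<^sub>M) \<and>
      (\<forall>j\<in>Basis. \<forall>q. (\<Sum>i\<in>Basis. y i q * g (E i) (E j) q) = \<rho> q * \<alpha> (E j) q)"
  proof (rule smooth_linear_system)
    show "g (E i) (E j) \<in> C\<^sub>M" "\<alpha> (E j) \<in> C\<^sub>M" for i j
      by (rule g_smooth[OF f(4,4)], rule form_smooth[OF \<alpha> f(4)])
    fix c and i :: 'e
    assume c: "\<And>j. j \<in> Basis \<Longrightarrow> (\<Sum>i\<in>Basis. c i * g (E i) (E j) p) = 0" and i: "i \<in> Basis"
    let ?X = "vf_lincomb Basis (\<lambda>i q. c i) E"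
    have X: "?X \<in> VF" by (rule VF_lincomb) (simp_all add: f(4))
    have "?X p = (\<lambda>f. 0)"
    proof (rule g_nondegenerate[OF X])
      fix Y assume Y: "Y \<in> VF"
      have "g ?X (E j) p = 0" if "j \<in> Basis" for j
        using g_lincomb[of "\<lambda>i q. c i" "E j" p] c[OF that] by (simp add: f)
      then show "g ?X Y p = 0" using F_g[OF X Y, of p] f(2) by simp
    qed
    then have "0 = (\<Sum>j\<in>Basis. c j * E j p (x i))" unfolding vf_lincomb_def by (simp add: fun_eq_iff)
    also have "\<dots> = (\<Sum>j\<in>Basis. if j = i then c j else 0)"
      by (rule sum.cong) (simp_all add: f(5) i)
    also have "\<dots> = c i" using i by simp
    finally show "c i = 0" by simp
  qed auto
  then obtain \<rho> y where \<rho>: "\<rho> \<in> C\<^sub>M" "\<rho> p \<noteq> 0" and y: "\<And>i. i \<in> Basis \<Longrightarrow> y i \<in> C\<^sub>M"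
    and e: "\<And>j q. j \<in> Basis \<Longrightarrow> (\<Sum>i\<in>Basis. y i q * g (E i) (E j) q) = \<rho> q * \<alpha> (E j) q" by blast
  let ?X = "vf_lincomb Basis y E"
  have X: "?X \<in> VF" by (rule VF_lincomb) (simp_all add: f(4) y)
  have "g (vf_scale w ?X) Y q = (\<rho> q * w q) * \<alpha> Y q" if Y: "Y \<in> VF" for Y q
  proof -
    have "g (vf_scale w ?X) Y q = (\<Sum>j\<in>Basis. Y q (x j) * g ?X (E j) q)"
      using F_g[OF X Y] by (simp add: g_scale_left X Y f)
    also have "\<dots> = (\<Sum>j\<in>Basis. Y q (x j) * (\<rho> q * \<alpha> (E j) q))"
      by (rule sum.cong) (simp_all add: g_lincomb[OF y f(4)] e)
    also have "\<dots> = \<rho> q * (w q * \<alpha> Y q)"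
      by (simp add: F[OF \<alpha> Y] sum_distrib_left mult_ac)
    finally show ?thesis by (simp add: mult_ac)
  qed
  then show ?thesis using X f(1,2) \<rho>
    by (intro exI[of _ "vf_scale w ?X"] exI[of _ "\<lambda>q. \<rho> q * w q"]) (simp add: VF_scale C_mult)
qed

text \<open>The local representatives \<open>W\<close> are glued by dividing by the factors \<open>\<rho>\<close>. By nondegeneracy the result
  does not depend on the representative that is used at a point.\<close>

lemma flat_g_surj:
  assumes \<alpha>: "\<alpha> \<in> \<Omega>"
  obtains X where "X \<in> VF" "flat_g A g X = \<alpha>"
proof -
  obtain W \<rho> where W: "\<And>p. W p \<in> VF" and \<rho>: "\<And>p. \<rho> p \<in> C\<^sub>M" "\<And>p. \<rho> p p \<noteq> 0"
    and e: "\<And>p Y q. Y \<in> VF \<Longrightarrow> g (W p) Y q = \<rho> p q * \<alpha> Y q"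
    using local_representative[OF \<alpha>] by metis
  \<comment> \<open>At each point \<open>q\<close> the representative belonging to \<open>q\<close> itself is used.\<close>
  define X where "X q f = inverse (\<rho> q q) * W q q f" for q f
  have WX: "W p q f = \<rho> p q * X q f" for p q f
  proof -
    have "vf_scale (\<lambda>_. \<rho> q q) (W p) q = vf_scale (\<lambda>_. \<rho> p q) (W q) q"
      by (rule g_eqI_at) (auto simp: VF_scale W g_scale_left e)
    then have "\<rho> q q * W p q f = \<rho> p q * W q q f" by (simp add: vf_scale_def fun_eq_iff)
    then show ?thesis using \<rho>(2)[of q] by (simp add: X_def field_simps)
  qed
  have X: "X \<in> VF"
  proof (rule VF_I)
    fix q
    have "X q = vf_scale (\<lambda>_. inverse (\<rho> q q)) (W q) q" by (simp add: X_def vf_scale_def fun_eq_iff)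
    then show "X q \<in> T\<^sub>M q" using VF_tangent[OF VF_scale[OF C_const W]] by metis
  next
    fix f assume f: "f \<in> C\<^sub>M"
    show "(\<lambda>q. X q f) \<in> C\<^sub>M"
    proof (rule C_local_quotient)
      fix p
      have "(\<lambda>q. \<rho> p q * X q f) \<in> C\<^sub>M" using VF_smooth[OF W f, of p] WX by simp
      then show "\<exists>r\<in>C\<^sub>M. r p \<noteq> 0 \<and> (\<lambda>q. r q * X q f) \<in> C\<^sub>M"
        using \<rho> by (intro bexI[of _ "\<rho> p"]) auto
    qed
  qed
  have "flat_g A g X = \<alpha>"
  proof (rule form_eqI[OF flat_g_in[OF X] \<alpha>])
    fix Y p assume Y: "Y \<in> VF"
    have "vf_scale (\<rho> p) X p = W p p" by (simp add: vf_scale_def fun_eq_iff WX)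
    then have "g (vf_scale (\<rho> p) X) Y p = g (W p) Y p"
      by (intro g_pointwise) (auto intro: VF_scale \<rho> X W Y)
    then show "flat_g A g X Y p = \<alpha> Y p"
      using \<rho> by (simp add: g_scale_left X Y e flat_g_apply)
  qed
  with X show ?thesis by (rule that)
qed

lemma flat_g_inj: "X \<in> VF \<Longrightarrow> Y \<in> VF \<Longrightarrow> flat_g A g X = flat_g A g Y \<Longrightarrow> X = Y"
  by (rule g_eqI) (auto dest: fun_cong simp flip: flat_g_apply)

end

section \<open>Lie brackets and the exterior derivative\<close>

context manifold begin

lemma lie_bracket_apply: "lie_bracket X Y p f = X p (\<lambda>q. Y q f) - Y p (\<lambda>q. X q f)"
  by (simp add: lie_bracket_def vf_apply_def)

lemma VF_eqI:
  assumes "X \<in> VF" "Y \<in> VF" "\<And>p f. f \<in> C\<^sub>M \<Longrightarrow> X p f = Y p f"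
  shows "X = Y"
proof (intro ext)
  fix p f show "X p f = Y p f"
  proof (cases "f \<in> C\<^sub>M")
    case False
    then show ?thesis using tangent_not_smooth[OF VF_tangent] assms(1,2) by metis
  qed (rule assms(3))
qed

lemma lie_bracket_minus: "lie_bracket Y X = vf_scale (\<lambda>p. -1) (lie_bracket X Y)"
  by (rule ext)+ (simp add: lie_bracket_apply vf_scale_def)

text \<open>The Jacobi identity, with the signs in which the exterior derivative of a two-form needs it.\<close>

lemma lie_bracket_Jacobi:
  assumes "X \<in> VF" "Y \<in> VF" "Z \<in> VF"
  shows "lie_bracket (lie_bracket X Z) Y =
    vf_add (lie_bracket (lie_bracket X Y) Z) (lie_bracket (lie_bracket Y Z) X)"
proof (rule VF_eqI)
  fix p f assume f: "f \<in> C\<^sub>M"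
  note s = VF_tangent_simps[OF assms(1)] VF_tangent_simps[OF assms(2)] VF_tangent_simps[OF assms(3)]
    VF_smooth[OF assms(1)] VF_smooth[OF assms(2)] VF_smooth[OF assms(3)]
  show "lie_bracket (lie_bracket X Z) Y p f =
      vf_add (lie_bracket (lie_bracket X Y) Z) (lie_bracket (lie_bracket Y Z) X) p f"
    using f by (simp add: vf_add_def lie_bracket_apply s)
qed (auto intro!: VF_lie_bracket VF_add assms)

lemma lie_bracket_diff_scale:
  assumes "X \<in> VF" "W \<in> VF" "Z \<in> VF" "a \<in> C\<^sub>M"
  shows "lie_bracket (vf_diff X (vf_scale a W)) Z =
    vf_add (vf_diff (lie_bracket X Z) (vf_scale a (lie_bracket W Z))) (vf_scale (vf_apply Z a) W)"
proof (rule VF_eqI)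
  fix p f assume f: "f \<in> C\<^sub>M"
  show "lie_bracket (vf_diff X (vf_scale a W)) Z p f =
      vf_add (vf_diff (lie_bracket X Z) (vf_scale a (lie_bracket W Z))) (vf_scale (vf_apply Z a) W) p f"
    using f assms(4)
    by (simp add: vf_add_def vf_diff_def vf_scale_def vf_apply_def lie_bracket_apply
        VF_tangent_simps[OF assms(3)] VF_smooth[OF assms(1)] VF_smooth[OF assms(2)] C_mult algebra_simps)
qed (auto intro!: VF_lie_bracket VF_add VF_diff VF_scale VF_apply assms)

lemma d_form_smooth:
  assumes \<alpha>: "\<alpha> \<in> \<Omega>" and X: "X \<in> VF" and Y: "Y \<in> VF"
  shows "d_form \<alpha> X Y \<in> C\<^sub>M"
  unfolding d_form_def
  by (rule C_diff[OF C_diff[OF VF_smooth[OF X form_smooth[OF \<alpha> Y]] VF_smooth[OF Y form_smooth[OF \<alpha> X]]]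
        form_smooth[OF \<alpha> VF_lie_bracket[OF X Y]]])

lemma d_form_antisym: "\<alpha> \<in> \<Omega> \<Longrightarrow> X \<in> VF \<Longrightarrow> Y \<in> VF \<Longrightarrow> d_form \<alpha> Y X p = - d_form \<alpha> X Y p"
  by (simp add: d_form_def lie_bracket_minus[of X Y] form_vf_scale VF_lie_bracket)

lemma d_form_closed:
  assumes \<alpha>: "\<alpha> \<in> \<Omega>" and X: "X \<in> VF" and Y: "Y \<in> VF" and Z: "Z \<in> VF"
  shows "X p (d_form \<alpha> Y Z) - Y p (d_form \<alpha> X Z) + Z p (d_form \<alpha> X Y)
    - d_form \<alpha> (lie_bracket X Y) Z p + d_form \<alpha> (lie_bracket X Z) Y p - d_form \<alpha> (lie_bracket Y Z) X p = 0"
proof -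
  have J: "\<alpha> (lie_bracket (lie_bracket X Z) Y) p =
      \<alpha> (lie_bracket (lie_bracket X Y) Z) p + \<alpha> (lie_bracket (lie_bracket Y Z) X) p"
    by (simp add: lie_bracket_Jacobi[OF X Y Z] form_vf_add \<alpha> VF_lie_bracket X Y Z)
  have e: "V p (d_form \<alpha> U W) = V p (\<lambda>q. U q (\<alpha> W)) - V p (\<lambda>q. W q (\<alpha> U)) - V p (\<alpha> (lie_bracket U W))"
    if "U \<in> VF" "V \<in> VF" "W \<in> VF" for U V W
    unfolding d_form_def
    using VF_smooth[OF that(1) form_smooth[OF \<alpha> that(3)]] VF_smooth[OF that(3) form_smooth[OF \<alpha> that(1)]]
      form_smooth[OF \<alpha> VF_lie_bracket[OF that(1,3)]]
    by (simp add: VF_tangent_simps[OF that(2)] C_diff)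
  show ?thesis
    unfolding e[OF Y X Z] e[OF X Y Z] e[OF X Z Y]
    using J by (simp add: d_form_def lie_bracket_apply)
qed

lemma lie_form_apply: "Z \<in> VF \<Longrightarrow> lie_form A X \<alpha> Z p = X p (\<alpha> Z) - \<alpha> (lie_bracket X Z) p"
  by (simp add: lie_form_def restrict_vf_def)

lemma lie_form_diff_scale:
  assumes \<beta>: "\<beta> \<in> \<Omega>" and X: "X \<in> VF" and W: "W \<in> VF" and Z: "Z \<in> VF" and a: "a \<in> C\<^sub>M"
  shows "lie_form A (vf_diff X (vf_scale a W)) \<beta> Z p =
    lie_form A X \<beta> Z p - a p * lie_form A W \<beta> Z p - Z p a * \<beta> W p"
  by (simp add: lie_form_apply Z lie_bracket_diff_scale[OF X W Z a] form_vf_add form_vf_diff form_vf_scale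
      VF_add VF_diff VF_scale VF_lie_bracket VF_apply \<beta> X W a)
     (simp add: vf_diff_def vf_scale_def vf_apply_def algebra_simps)

end

section \<open>Uniqueness of torsion-free metric connections\<close>

text \<open>The difference of two such connections gives a trilinear expression that is symmetric in the
  first two and antisymmetric in the last two arguments; going around the six permutations shows
  that it equals its own negative.\<close>

lemma (in pseudo_riemannian_manifold) torsion_free_metric_unique:
  assumes B: "\<And>X Y. X \<in> VF \<Longrightarrow> Y \<in> VF \<Longrightarrow> B X Y \<in> VF"
    and N: "\<And>X Y. X \<in> VF \<Longrightarrow> Y \<in> VF \<Longrightarrow> N X Y \<in> VF"
    and tB: "\<And>X Y. X \<in> VF \<Longrightarrow> Y \<in> VF \<Longrightarrow> vf_diff (B X Y) (B Y X) = lie_bracket X Y"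
    and tN: "\<And>X Y. X \<in> VF \<Longrightarrow> Y \<in> VF \<Longrightarrow> vf_diff (N X Y) (N Y X) = lie_bracket X Y"
    and mB: "\<And>X Y Z p. X \<in> VF \<Longrightarrow> Y \<in> VF \<Longrightarrow> Z \<in> VF \<Longrightarrow> X p (g Y Z) = g (B X Y) Z p + g Y (B X Z) p"
    and mN: "\<And>X Y Z p. X \<in> VF \<Longrightarrow> Y \<in> VF \<Longrightarrow> Z \<in> VF \<Longrightarrow> X p (g Y Z) = g (N X Y) Z p + g Y (N X Z) p"
    and X: "X \<in> VF" and Y: "Y \<in> VF"
  shows "B X Y = N X Y"
proof (rule g_eqI[OF B[OF X Y] N[OF X Y]])
  fix Z p assume Z: "Z \<in> VF"
  define S where "S X Y Z = g (B X Y) Z p - g (N X Y) Z p" for X Y Z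
  have sym: "S X Y Z = S Y X Z" if "X \<in> VF" "Y \<in> VF" "Z \<in> VF" for X Y Z
  proof -
    have "g (vf_diff (B X Y) (B Y X)) Z p = g (vf_diff (N X Y) (N Y X)) Z p"
      by (simp add: tB tN that)
    then show ?thesis by (simp add: S_def g_diff_left B N that)
  qed
  have anti: "S X Y Z = - S X Z Y" if "X \<in> VF" "Y \<in> VF" "Z \<in> VF" for X Y Z
    using mB[OF that, of p] mN[OF that, of p] g_sym[OF that(2) B[OF that(1,3)]] g_sym[OF that(2) N[OF that(1,3)]]
    by (simp add: S_def)
  have "S X Y Z = 0"
    using sym[OF X Y Z] anti[OF Y X Z] sym[OF Y Z X] anti[OF Z Y X] sym[OF Z X Y] anti[OF X Z Y]
    by linarith
  then show "g (B X Y) Z p = g (N X Y) Z p" by (simp add: S_def)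
qed

section \<open>Contact pseudo-metric structures\<close>

locale contact_metric = pseudo_riemannian_manifold A g
  for A :: "('a::{t2_space,second_countable_topology}, 'e::euclidean_space) chart set"
    and g :: "'a two_tensor" +
  fixes \<Phi> :: "'a vector_field \<Rightarrow> 'a vector_field" and \<xi> :: "'a vector_field" and \<eta> :: "'a one_form"
  assumes almost_contact: "pseudo_riemannian_almost_contact A \<Phi> \<xi> \<eta> g"
    and d_form_\<eta>: "X \<in> vector_fields A \<Longrightarrow> Y \<in> vector_fields A \<Longrightarrow> d_form \<eta> X Y = g X (\<Phi> Y)"
begin

abbreviation "zero_vf \<equiv> (\<lambda>p f. 0) :: 'a vector_field"

lemma \<xi>: "\<xi> \<in> VF" and \<eta>: "\<eta> \<in> \<Omega>" and \<eta>_\<xi>: "\<eta> \<xi> = (\<lambda>p. 1)"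
  and \<Phi>: "X \<in> VF \<Longrightarrow> \<Phi> X \<in> VF"
  and \<Phi>_add: "X \<in> VF \<Longrightarrow> Y \<in> VF \<Longrightarrow> \<Phi> (vf_add X Y) = vf_add (\<Phi> X) (\<Phi> Y)"
  and \<Phi>_scale: "\<phi> \<in> C\<^sub>M \<Longrightarrow> X \<in> VF \<Longrightarrow> \<Phi> (vf_scale \<phi> X) = vf_scale \<phi> (\<Phi> X)"
  and \<Phi>_\<Phi>: "X \<in> VF \<Longrightarrow> \<Phi> (\<Phi> X) = vf_diff (vf_scale (\<eta> X) \<xi>) X"
  and g_\<Phi>_\<Phi>: "X \<in> VF \<Longrightarrow> Y \<in> VF \<Longrightarrow> g (\<Phi> X) (\<Phi> Y) = (\<lambda>p. g X Y p - \<eta> X p * \<eta> Y p)"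
  using almost_contact unfolding pseudo_riemannian_almost_contact_def endomorphism_field_def by auto

lemma \<Phi>_diff: "X \<in> VF \<Longrightarrow> Y \<in> VF \<Longrightarrow> \<Phi> (vf_diff X Y) = vf_diff (\<Phi> X) (\<Phi> Y)"
  by (simp add: vf_diff_eq \<Phi>_add \<Phi>_scale VF_scale)

lemma \<Phi>_zero: "\<Phi> zero_vf = zero_vf"
  using \<Phi>_scale[of "\<lambda>p. 0" zero_vf] by (simp add: vf_scale_def VF_zero)

lemma \<eta>_smooth: "X \<in> VF \<Longrightarrow> \<eta> X \<in> C\<^sub>M"
  by (rule form_smooth[OF \<eta>])

text \<open>Computing \<open>\<Phi>\<^sup>3 \<xi>\<close> in two ways gives \<open>\<Phi> \<xi> = \<eta>(\<Phi> \<xi>) \<xi>\<close>; applying \<open>\<Phi>\<close> once more shows that the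
  square of this factor is \<open>0\<close>.\<close>

lemma \<Phi>_\<xi>: "\<Phi> \<xi> = zero_vf"
proof -
  let ?f = "\<eta> (\<Phi> \<xi>)"
  have f: "?f \<in> C\<^sub>M" by (intro \<eta>_smooth \<Phi> \<xi>)
  have 0: "\<Phi> (\<Phi> \<xi>) = zero_vf" using \<Phi>_\<Phi>[OF \<xi>] by (simp add: \<eta>_\<xi> vf_diff_def vf_scale_def)
  have "vf_diff (vf_scale ?f \<xi>) (\<Phi> \<xi>) = zero_vf" using \<Phi>_\<Phi>[OF \<Phi>[OF \<xi>]] by (simp add: 0 \<Phi>_zero)
  then have e: "\<Phi> \<xi> = vf_scale ?f \<xi>" by (simp add: vf_diff_def vf_scale_def fun_eq_iff)
  have "\<Phi> (\<Phi> \<xi>) = vf_scale ?f (\<Phi> \<xi>)" by (subst e) (rule \<Phi>_scale[OF f \<xi>])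
  then have "\<eta> (\<Phi> (\<Phi> \<xi>)) = (\<lambda>p. ?f p * ?f p)" using form_vf_scale[OF \<eta> f \<Phi>[OF \<xi>]] by simp
  then have "?f p = 0" for p by (simp add: 0 form_vf_zero[OF \<eta>] fun_eq_iff)
  with e show ?thesis by (simp add: vf_scale_def)
qed

text \<open>Again two ways of computing \<open>\<Phi>\<^sup>3\<close>.\<close>

lemma \<eta>_\<Phi>: assumes X: "X \<in> VF" shows "\<eta> (\<Phi> X) = (\<lambda>p. 0)"
proof -
  have "\<Phi> (\<Phi> (\<Phi> X)) = vf_diff (vf_scale (\<eta> X) (\<Phi> \<xi>)) (\<Phi> X)"
    by (simp add: \<Phi>_\<Phi>[OF X] \<Phi>_diff \<Phi>_scale VF_scale \<eta>_smooth X \<xi>)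
  then have "vf_diff (vf_scale (\<eta> (\<Phi> X)) \<xi>) (\<Phi> X) = vf_diff zero_vf (\<Phi> X)"
    using \<Phi>_\<Phi>[OF \<Phi>[OF X]] by (simp add: \<Phi>_\<xi> vf_scale_def)
  then have "vf_scale (\<eta> (\<Phi> X)) \<xi> = zero_vf" by (simp add: vf_diff_def fun_eq_iff)
  then have "\<eta> (vf_scale (\<eta> (\<Phi> X)) \<xi>) = (\<lambda>p. 0)" by (simp add: form_vf_zero[OF \<eta>])
  then show ?thesis by (simp add: form_vf_scale \<eta> \<eta>_smooth \<Phi> X \<xi> \<eta>_\<xi>)
qed

lemma g_zero: "Y \<in> VF \<Longrightarrow> g zero_vf Y = (\<lambda>p. 0)"
  using form_vf_zero[OF flat_g_in, of Y] by (simp add: flat_g_apply VF_zero g_sym)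

lemma g_\<xi>: "Y \<in> VF \<Longrightarrow> g \<xi> Y = \<eta> Y"
  using g_\<Phi>_\<Phi>[OF \<xi>, of Y] by (simp add: \<Phi>_\<xi> \<eta>_\<xi> g_zero \<Phi> fun_eq_iff)

abbreviation \<omega> where "\<omega> \<equiv> d_form \<eta>"

lemma \<omega>_\<xi>_right: "X \<in> VF \<Longrightarrow> \<omega> X \<xi> = (\<lambda>p. 0)"
  by (simp add: d_form_\<eta> \<xi> \<Phi>_\<xi> g_sym[OF _ VF_zero] g_zero)

lemma \<omega>_\<xi>_left: "X \<in> VF \<Longrightarrow> \<omega> \<xi> X = (\<lambda>p. 0)"
  using d_form_antisym[OF \<eta> _ \<xi>, of X] \<omega>_\<xi>_right by (simp add: fun_eq_iff)

lemma \<omega>_diff_left: "X \<in> VF \<Longrightarrow> Y \<in> VF \<Longrightarrow> Z \<in> VF \<Longrightarrow> \<omega> (vf_diff X Y) Z = (\<lambda>p. \<omega> X Z p - \<omega> Y Z p)"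
  by (simp add: d_form_\<eta> VF_diff g_diff_left \<Phi>)

lemma \<omega>_scale_right: "X \<in> VF \<Longrightarrow> Y \<in> VF \<Longrightarrow> \<phi> \<in> C\<^sub>M \<Longrightarrow> \<omega> X (vf_scale \<phi> Y) = (\<lambda>p. \<phi> p * \<omega> X Y p)"
  by (simp add: d_form_\<eta> VF_scale \<Phi>_scale g_scale_right \<Phi>)

lemma \<omega>_diff_right: "X \<in> VF \<Longrightarrow> Y \<in> VF \<Longrightarrow> Z \<in> VF \<Longrightarrow> \<omega> X (vf_diff Y Z) = (\<lambda>p. \<omega> X Y p - \<omega> X Z p)"
  by (simp add: d_form_\<eta> VF_diff \<Phi>_diff g_diff_right \<Phi>)

text \<open>The isometry that relates the two musical isomorphisms: \<open>\<flat>\<^sub>\<eta> = \<flat>\<^sub>g \<circ> T\<close>. Its inverse is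
  \<open>\<eta> \<otimes> \<xi> - \<Phi>\<close>.\<close>

definition T where "T X = vf_add (\<Phi> X) (vf_scale (\<eta> X) \<xi>)"

lemma T: "X \<in> VF \<Longrightarrow> T X \<in> VF"
  unfolding T_def by (intro VF_add VF_scale \<Phi> \<xi> \<eta>_smooth)

lemma g_T_T: "X \<in> VF \<Longrightarrow> Y \<in> VF \<Longrightarrow> g (T X) (T Y) = g X Y"
  unfolding T_def
  by (simp add: g_add_left g_add_right g_scale_left g_scale_right VF_add VF_scale \<Phi> \<xi> \<eta>_smooth
      g_\<Phi>_\<Phi> g_\<xi> g_sym[OF \<Phi> \<xi>] \<eta>_\<Phi> \<eta>_\<xi>)

lemma T_surj:
  assumes X: "X \<in> VF"
  shows "\<exists>Y\<in>VF. T Y = X"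
proof
  let ?Y = "vf_diff (vf_scale (\<eta> X) \<xi>) (\<Phi> X)"
  show "?Y \<in> VF" by (intro VF_diff VF_scale \<Phi> \<xi> \<eta>_smooth X)
  have "\<Phi> ?Y = vf_diff X (vf_scale (\<eta> X) \<xi>)"
    by (simp add: \<Phi>_diff \<Phi>_scale VF_scale \<eta>_smooth \<Phi> X \<xi> \<Phi>_\<Phi> \<Phi>_\<xi>) (simp add: vf_diff_def vf_scale_def)
  moreover have "\<eta> ?Y = \<eta> X"
    by (simp add: form_vf_diff form_vf_scale \<eta> VF_scale \<eta>_smooth \<Phi> X \<xi> \<eta>_\<Phi> \<eta>_\<xi>)
  ultimately show "T ?Y = X" by (simp add: T_def vf_add_def vf_diff_def)
qed

abbreviation "flat \<equiv> flat_eta A \<eta>"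
abbreviation "sharp \<equiv> sharp_eta A \<eta>"
abbreviation "\<pi> \<equiv> contact_bivector A \<eta>"

lemma flat_apply: "Y \<in> VF \<Longrightarrow> flat X Y = (\<lambda>p. - \<omega> X Y p + \<eta> X p * \<eta> Y p)"
  by (simp add: flat_eta_def restrict_vf_def)

lemma flat_eq: "X \<in> VF \<Longrightarrow> flat X = flat_g A g (T X)"
proof
  fix Y assume X: "X \<in> VF"
  show "flat X Y = flat_g A g (T X) Y"
  proof (cases "Y \<in> VF")
    case True
    have "\<omega> X Y p = - g (\<Phi> X) Y p" for p
      using d_form_antisym[OF \<eta> True X, of p] X True by (simp add: d_form_\<eta> g_sym[OF \<Phi>])
    then show ?thesis using X True
      by (simp add: flat_apply flat_g_apply T_def g_add_left g_scale_left VF_scale \<Phi> \<xi> \<eta>_smooth g_\<xi>)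
  qed (simp add: flat_eta_def flat_g_def restrict_vf_def)
qed

lemma flat: "X \<in> VF \<Longrightarrow> flat X \<in> \<Omega>"
  by (simp add: flat_eq flat_g_in T)

lemma flat_inj: assumes "X \<in> VF" "Y \<in> VF" "flat X = flat Y" shows "X = Y"
proof (rule g_eqI[OF assms(1,2)])
  fix Z p assume "Z \<in> VF"
  moreover have "T X = T Y" using assms by (intro flat_g_inj T) (simp_all add: flat_eq)
  ultimately show "g X Z p = g Y Z p" using g_T_T assms by metis
qed

lemma flat_surj: assumes "\<alpha> \<in> \<Omega>" obtains X where "X \<in> VF" "flat X = \<alpha>"
proof -
  obtain Y where "Y \<in> VF" "flat_g A g Y = \<alpha>" using flat_g_surj[OF assms] .
  moreover obtain X where "X \<in> VF" "T X = Y" using T_surj[OF \<open>Y \<in> VF\<close>] by blast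
  ultimately show ?thesis using that[of X] by (simp add: flat_eq)
qed

lemma sharp_flat: "X \<in> VF \<Longrightarrow> sharp (flat X) = X"
  unfolding sharp_eta_def by (rule inv_into_f_f) (auto intro: inj_onI flat_inj)

lemma sharp: assumes "\<alpha> \<in> \<Omega>" shows "sharp \<alpha> \<in> VF" "flat (sharp \<alpha>) = \<alpha>"
proof -
  obtain X where "X \<in> VF" "flat X = \<alpha>" using flat_surj[OF assms] .
  then show "sharp \<alpha> \<in> VF" "flat (sharp \<alpha>) = \<alpha>" using sharp_flat by auto
qed

lemma sharp_g_flat_g: "X \<in> VF \<Longrightarrow> sharp_g A g (flat_g A g X) = X"
  unfolding sharp_g_def by (rule inv_into_f_f) (auto intro: inj_onI flat_g_inj)

lemma cometric_flat: "X \<in> VF \<Longrightarrow> Y \<in> VF \<Longrightarrow> cometric A g (flat X) (flat Y) = g X Y"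
  by (simp add: cometric_def flat_eq sharp_g_flat_g T g_T_T)

lemma \<pi>_flat: "X \<in> VF \<Longrightarrow> Y \<in> VF \<Longrightarrow> \<pi> (flat X) (flat Y) = \<omega> X Y"
  by (simp add: contact_bivector_def sharp_flat)

lemma flat_\<xi>: "X \<in> VF \<Longrightarrow> flat X \<xi> = \<eta> X"
  by (simp add: flat_apply \<xi> \<omega>_\<xi>_right \<eta>_\<xi>)

text \<open>The key to the Jacobi structure: pairing with the horizontal part \<open>X - \<eta>(X) \<xi>\<close> recovers \<open>d\<eta>\<close>, so
  that this part is \<open>\<sharp>\<^sub>\<pi>(\<flat>\<^sub>\<eta> X)\<close>.\<close>

lemma flat_horizontal:
  assumes X: "X \<in> VF" and Y: "Y \<in> VF"
  shows "flat Y (vf_diff X (vf_scale (\<eta> X) \<xi>)) = \<omega> X Y"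
proof -
  have "vf_diff X (vf_scale (\<eta> X) \<xi>) \<in> VF" by (intro VF_diff VF_scale \<xi> \<eta>_smooth X)
  then show ?thesis
    using d_form_antisym[OF \<eta> X Y]
    by (simp add: flat_apply \<omega>_diff_right \<omega>_scale_right \<omega>_\<xi>_right form_vf_diff[OF \<eta>] form_vf_scale[OF \<eta>]
        VF_scale \<eta>_smooth \<xi> \<eta>_\<xi> X Y)
qed

lemma sharp_pi_flat:
  assumes X: "X \<in> VF"
  shows "sharp_pi A \<pi> (flat X) = vf_diff X (vf_scale (\<eta> X) \<xi>)"
  unfolding sharp_pi_def
proof (rule the_equality, intro conjI ballI)
  let ?X = "vf_diff X (vf_scale (\<eta> X) \<xi>)"
  show V: "?X \<in> VF" by (intro VF_diff VF_scale \<xi> \<eta>_smooth X)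
  fix \<beta> assume "\<beta> \<in> \<Omega>"
  then obtain Y where Y: "Y \<in> VF" "flat Y = \<beta>" using flat_surj by blast
  then show "\<beta> ?X = \<pi> (flat X) \<beta>" using flat_horizontal[OF X Y(1)] \<pi>_flat[OF X Y(1)] by simp
next
  let ?X = "vf_diff X (vf_scale (\<eta> X) \<xi>)"
  fix W assume W: "W \<in> VF \<and> (\<forall>\<beta>\<in>\<Omega>. \<beta> W = \<pi> (flat X) \<beta>)"
  have V: "?X \<in> VF" by (intro VF_diff VF_scale \<xi> \<eta>_smooth X)
  show "W = ?X"
  proof (rule g_eqI[OF _ V])
    show "W \<in> VF" using W by blast
    fix Z p assume Z: "Z \<in> VF"
    obtain Y where Y: "Y \<in> VF" "flat Y = flat_g A g Z" using flat_surj[OF flat_g_in[OF Z]] .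
    have "flat Y ?X = \<omega> X Y" by (rule flat_horizontal[OF X Y(1)])
    moreover have "flat Y W = \<omega> X Y" using W flat[OF Y(1)] \<pi>_flat[OF X Y(1)] by simp
    ultimately show "g W Z p = g ?X Z p"
      using W V Z Y(2) by (simp add: flat_g_apply g_sym[OF _ Z])
  qed
qed

lemma sharp_pi_xi_flat: "X \<in> VF \<Longrightarrow> sharp_pi_xi A \<pi> \<xi> (flat X) = X"
  by (simp add: sharp_pi_xi_def sharp_pi_flat flat_\<xi>) (simp add: vf_add_def vf_diff_def)

lemma flat_g_\<xi>: "flat_g A g \<xi> = \<eta>"
  by (rule form_eqI[OF flat_g_in[OF \<xi>] \<eta>]) (simp add: flat_g_apply g_\<xi>)

text \<open>The form \<open>\<flat>\<^sub>g \<xi>\<close> is \<open>\<eta> = \<flat>\<^sub>\<eta> \<xi>\<close>, and it lies in the kernel of \<open>\<pi>\<close> because \<open>i\<^sub>\<xi> d\<eta> = 0\<close>.\<close>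

lemma J_field_\<xi>: "J_field A \<pi> g \<xi> = zero_vf"
proof -
  have \<pi>0: "\<pi> \<eta> \<beta> = (\<lambda>p. 0)" if \<beta>: "\<beta> \<in> \<Omega>" for \<beta>
  proof -
    obtain Y where Y: "Y \<in> VF" "flat Y = \<beta>" using flat_surj[OF \<beta>] .
    have "flat \<xi> = \<eta>"
      by (rule form_eqI[OF flat[OF \<xi>] \<eta>]) (simp add: flat_apply \<omega>_\<xi>_left \<eta>_\<xi>)
    then show ?thesis using \<pi>_flat[OF \<xi> Y(1)] Y by (simp add: \<omega>_\<xi>_left)
  qed
  have \<alpha>\<eta>: "\<alpha> = \<eta>" if \<alpha>: "\<alpha> \<in> \<Omega>" "sharp_g A g \<alpha> = \<xi>" for \<alpha>
  proof -
    obtain W where W: "W \<in> VF" "flat_g A g W = \<alpha>" using flat_g_surj[OF \<alpha>(1)] .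
    then have "W = \<xi>" using \<alpha>(2) sharp_g_flat_g by metis
    then show ?thesis using W(2) flat_g_\<xi> by simp
  qed
  have sg: "sharp_g A g \<beta> \<in> VF" if \<beta>: "\<beta> \<in> \<Omega>" for \<beta>
    using flat_g_surj[OF \<beta>] sharp_g_flat_g by metis
  show ?thesis
    unfolding J_field_def
  proof (rule the_equality, intro conjI ballI impI)
    show "zero_vf \<in> VF" by (rule VF_zero)
    fix \<alpha> \<beta> assume \<alpha>: "\<alpha> \<in> \<Omega>" "sharp_g A g \<alpha> = \<xi>" and \<beta>: "\<beta> \<in> \<Omega>"
    show "g zero_vf (sharp_g A g \<beta>) = \<pi> \<alpha> \<beta>"
      using \<alpha>\<eta>[OF \<alpha>] \<pi>0[OF \<beta>] g_zero[OF sg[OF \<beta>]] by simp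
  next
    fix Z assume Z: "Z \<in> VF \<and> (\<forall>\<alpha>\<in>\<Omega>. \<forall>\<beta>\<in>\<Omega>. sharp_g A g \<alpha> = \<xi> \<longrightarrow> g Z (sharp_g A g \<beta>) = \<pi> \<alpha> \<beta>)"
    have "sharp_g A g \<eta> = \<xi>" using sharp_g_flat_g[OF \<xi>] flat_g_\<xi> by simp
    then have z: "g Z (sharp_g A g \<beta>) = (\<lambda>p. 0)" if "\<beta> \<in> \<Omega>" for \<beta>
      using Z \<eta> that \<pi>0[OF that] by simp
    show "Z = zero_vf"
    proof (rule g_eqI)
      fix Y p assume Y: "Y \<in> VF"
      show "g Z Y p = g zero_vf Y p"
        using z[OF flat_g_in[OF Y]] by (simp add: sharp_g_flat_g Y g_zero)
    qed (use Z VF_zero in auto)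
  qed
qed

lemma lambda_g_eq: "lambda_g A \<pi> \<xi> g = \<eta>"
proof -
  have "flat_g A g zero_vf Y = (\<lambda>p. 0)" for Y
    by (simp add: flat_g_def restrict_vf_def g_zero)
  then show ?thesis
    by (simp add: lambda_g_def J_field_\<xi> flat_g_\<xi> form_diff_def form_scale_def g_\<xi>[OF \<xi>] \<eta>_\<xi>)
qed

text \<open>The contact form turns the bracket of one-forms into the Lie bracket. After the horizontal parts
  are expanded by \<open>L\<^sub>X\<^sub>-\<^sub>a\<^sub>\<xi> \<beta> = L\<^sub>X \<beta> - a L\<^sub>\<xi> \<beta> - \<beta>(\<xi>) da\<close>, the terms with \<open>L\<^sub>\<xi>\<close> cancel, the definition of
  \<open>d\<eta>\<close> disposes of the derivatives of \<open>\<eta>(X)\<close>, \<open>\<eta>(Y)\<close> and \<open>\<eta>(Z)\<close>, and what remains is \<open>d(d\<eta>) = 0\<close>.\<close>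

lemma bracket_g_flat:
  assumes X: "X \<in> VF" and Y: "Y \<in> VF" and Z: "Z \<in> VF"
  shows "bracket_g A \<pi> \<xi> g (flat X) (flat Y) Z p = flat (lie_bracket X Y) Z p"
proof -
  let ?a = "\<eta> X" and ?b = "\<eta> Y" and ?c = "\<eta> Z"
  note V = VF_lie_bracket[OF X Y] VF_lie_bracket[OF X Z] VF_lie_bracket[OF Y Z]
  have L: "lie_form A U (flat W) Z p = - U p (\<omega> W Z) + U p (\<eta> W) * ?c p + \<eta> W p * U p ?c
      + \<omega> W (lie_bracket U Z) p - \<eta> W p * \<eta> (lie_bracket U Z) p" if "U \<in> VF" "W \<in> VF" for U W
  proof -
    have "U p (\<lambda>q. - \<omega> W Z q + \<eta> W q * ?c q) = - U p (\<omega> W Z) + (\<eta> W p * U p ?c + ?c p * U p (\<eta> W))"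
      using VF_tangent_simps[OF that(1)] that
      by (simp add: \<eta>_smooth Z d_form_smooth[OF \<eta>] C_uminus C_mult)
    then show ?thesis
      by (simp add: lie_form_apply Z flat_apply VF_lie_bracket that algebra_simps)
  qed
  have "bracket_g A \<pi> \<xi> g (flat X) (flat Y) Z p =
      lie_form A (vf_diff X (vf_scale ?a \<xi>)) (flat Y) Z p - lie_form A (vf_diff Y (vf_scale ?b \<xi>)) (flat X) Z p
      - Z p (\<omega> X Y) + ?a p * (lie_form A \<xi> (flat Y) Z p - flat Y Z p)
      - ?b p * (lie_form A \<xi> (flat X) Z p - flat X Z p) - \<omega> X Y p * ?c p"
    by (simp add: bracket_g_def bracket_pi_xi_def bracket_pi_def form_diff_def form_add_def form_scale_def
        lambda_g_eq sharp_pi_flat \<pi>_flat flat_\<xi> X Y d_fun_def restrict_vf_def Z vf_apply_def)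
  also have "\<dots> = lie_form A X (flat Y) Z p - lie_form A Y (flat X) Z p - ?b p * Z p ?a + ?a p * Z p ?b
      - Z p (\<omega> X Y) - ?a p * flat Y Z p + ?b p * flat X Z p - \<omega> X Y p * ?c p"
    by (simp add: lie_form_diff_scale[OF flat] X Y Z \<xi> \<eta>_smooth flat_\<xi> algebra_simps)
  also have "\<dots> = flat (lie_bracket X Y) Z p"
  proof -
    have d: "\<omega> X Y p = X p ?b - Y p ?a - \<eta> (lie_bracket X Y) p"
      "\<omega> X Z p = X p ?c - Z p ?a - \<eta> (lie_bracket X Z) p"
      "\<omega> Y Z p = Y p ?c - Z p ?b - \<eta> (lie_bracket Y Z) p"
      by (simp_all add: d_form_def)
    \<comment> \<open>Closedness of \<open>d\<eta>\<close>, solved for \<open>X(d\<eta>(Y,Z))\<close>.\<close>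
    have k: "X p (\<omega> Y Z) = Y p (\<omega> X Z) - Z p (\<omega> X Y)
        + \<omega> (lie_bracket X Y) Z p + \<omega> Y (lie_bracket X Z) p - \<omega> X (lie_bracket Y Z) p"
      using d_form_closed[OF \<eta> X Y Z, of p] d_form_antisym[OF \<eta> Y V(2), of p] d_form_antisym[OF \<eta> X V(3), of p]
      by simp
    have x: "X p ?b = \<omega> X Y p + Y p ?a + \<eta> (lie_bracket X Y) p"
      "X p ?c = \<omega> X Z p + Z p ?a + \<eta> (lie_bracket X Z) p"
      "Y p ?c = \<omega> Y Z p + Z p ?b + \<eta> (lie_bracket Y Z) p"
      using d by simp_all
    show ?thesis
      unfolding L[OF X Y] L[OF Y X] flat_apply[OF Z] k x by (simp add: algebra_simps)
  qed
  finally show ?thesis .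
qed

lemma flat_vf_diff:
  "X \<in> VF \<Longrightarrow> Y \<in> VF \<Longrightarrow> Z \<in> VF \<Longrightarrow> flat (vf_diff X Y) Z p = flat X Z p - flat Y Z p"
  by (simp add: flat_apply \<omega>_diff_left form_vf_diff[OF \<eta>] algebra_simps)

text \<open>Transported to vector fields by \<open>\<flat>\<^sub>\<eta>\<close>, the contravariant derivative is torsion-free by
  \<open>bracket_g_flat\<close> and metric by \<open>sharp_pi_xi_flat\<close> and \<open>cometric_flat\<close>.\<close>

lemma contravariant_eq_covariant:
  assumes D: "is_contravariant_levi_civita A \<pi> \<xi> g D"
    and N: "is_levi_civita_connection A g nabla"
    and X: "X \<in> VF" and Y: "Y \<in> VF"
  shows "sharp (D (flat X) (flat Y)) = nabla X Y"
proof (rule torsion_free_metric_unique[where B = "\<lambda>X Y. sharp (D (flat X) (flat Y))" and N = nabla, OF _ _ _ _ _ _ X Y])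
  fix X Y assume X: "X \<in> VF" and Y: "Y \<in> VF"
  have Din: "D (flat X) (flat Y) \<in> \<Omega>" if "X \<in> VF" "Y \<in> VF" for X Y
    using D flat[OF that(1)] flat[OF that(2)]
    unfolding is_contravariant_levi_civita_def is_contravariant_derivative_def by blast
  note B = sharp[OF Din]
  show "sharp (D (flat X) (flat Y)) \<in> VF" by (rule B(1)[OF X Y])
  show "nabla X Y \<in> VF" "vf_diff (nabla X Y) (nabla Y X) = lie_bracket X Y"
    using N X Y unfolding is_levi_civita_connection_def by blast+
  show "vf_diff (sharp (D (flat X) (flat Y))) (sharp (D (flat Y) (flat X))) = lie_bracket X Y" (is "?L = ?R")
  proof (rule flat_inj)
    show L: "?L \<in> VF" and R: "?R \<in> VF" using B(1) X Y by (simp_all add: VF_diff VF_lie_bracket)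
    show "flat ?L = flat ?R"
    proof (rule form_eqI[OF flat[OF L] flat[OF R]])
      fix Z p assume Z: "Z \<in> VF"
      have "form_diff (D (flat X) (flat Y)) (D (flat Y) (flat X)) = bracket_g A \<pi> \<xi> g (flat X) (flat Y)"
        using D flat[OF X] flat[OF Y] unfolding is_contravariant_levi_civita_def by blast
      then have "D (flat X) (flat Y) Z p - D (flat Y) (flat X) Z p = flat ?R Z p"
        using bracket_g_flat[OF X Y Z, of p] by (simp add: form_diff_def fun_eq_iff)
      then show "flat ?L Z p = flat ?R Z p"
        using X Y Z by (simp add: flat_vf_diff B)
    qed
  qed
  fix Z p assume Z: "Z \<in> VF"
  have "vf_apply X (g Y Z) = (\<lambda>p. g (nabla X Y) Z p + g Y (nabla X Z) p)"
    using N X Y Z unfolding is_levi_civita_connection_def by blast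
  then show "X p (g Y Z) = g (nabla X Y) Z p + g Y (nabla X Z) p"
    by (simp add: vf_apply_def fun_eq_iff)
  have "vf_apply (sharp_pi_xi A \<pi> \<xi> (flat X)) (cometric A g (flat Y) (flat Z)) =
      (\<lambda>p. cometric A g (D (flat X) (flat Y)) (flat Z) p + cometric A g (flat Y) (D (flat X) (flat Z)) p)"
    using D flat[OF X] flat[OF Y] flat[OF Z] unfolding is_contravariant_levi_civita_def by blast
  moreover have "cometric A g (D (flat X) (flat Y)) (flat Z) = g (sharp (D (flat X) (flat Y))) Z"
    using cometric_flat[OF B(1)[OF X Y] Z] B(2)[OF X Y] by simp
  moreover have "cometric A g (flat Y) (D (flat X) (flat Z)) = g Y (sharp (D (flat X) (flat Z)))"
    using cometric_flat[OF Y B(1)[OF X Z]] B(2)[OF X Z] by simp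
  ultimately show "X p (g Y Z) = g (sharp (D (flat X) (flat Y))) Z p + g Y (sharp (D (flat X) (flat Z))) p"
    using X Y Z by (simp add: sharp_pi_xi_flat cometric_flat vf_apply_def fun_eq_iff)
qed

end

theorem mainTheorem5:
  fixes A :: "('a::{t2_space,second_countable_topology}, 'e::euclidean_space) chart set"
    and n :: nat
    and \<eta> :: "'a one_form"
    and g :: "'a two_tensor"
    and \<pi> :: "'a bivector"
    and \<xi> :: "'a vector_field"
    and D :: "'a one_form \<Rightarrow> 'a one_form \<Rightarrow> 'a one_form"
    and nabla :: "'a vector_field \<Rightarrow> 'a vector_field \<Rightarrow> 'a vector_field"
  assumes "pseudo_riemannian_contact_manifold n A \<eta> g"
    and "\<pi> = contact_bivector A \<eta>"
    and "\<xi> = reeb_field A \<eta>"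
    and "is_contravariant_levi_civita A \<pi> \<xi> g D"
    and "is_levi_civita_connection A g nabla"
  shows "\<forall>\<alpha>\<in>one_forms A. \<forall>\<beta>\<in>one_forms A.
           sharp_eta A \<eta> (D \<alpha> \<beta>) = nabla (sharp_eta A \<eta> \<alpha>) (sharp_eta A \<eta> \<beta>)"
proof -
  obtain \<Phi> where "pseudo_riemannian_almost_contact A \<Phi> \<xi> \<eta> g"
    "\<forall>X\<in>vector_fields A. \<forall>Y\<in>vector_fields A. g X (\<Phi> Y) = d_form \<eta> X Y"
    and "smooth_manifold A" "pseudo_riemannian_metric A g"
    using assms(1,3) unfolding pseudo_riemannian_contact_manifold_def by blast
  then interpret contact_metric A g \<Phi> \<xi> \<eta>
    by unfold_locales simp_all
  show ?thesis
  proof (intro ballI)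
    fix \<alpha> \<beta> assume "\<alpha> \<in> \<Omega>" "\<beta> \<in> \<Omega>"
    then show "sharp (D \<alpha> \<beta>) = nabla (sharp \<alpha>) (sharp \<beta>)"
      using contravariant_eq_covariant[OF assms(4)[unfolded assms(2)] assms(5) sharp(1) sharp(1)]
      by (simp add: sharp(2))
  qed
qed

end
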